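(* Let $X$ be a non-separable Banach space admitting a $1$-projectional skeleton and let $\kappa=\operatorname{dens} X$. Then there is a projectional resolution of the identity $(P_\alpha)_{\alpha\le\kappa}$ on $X$ such that the space $(P_{\alpha+1}-P_\alpha)X$ admits a $1$-projectional skeleton for each $\alpha<\kappa$. In other words, the class of Banach spaces admitting a $1$-projectional skeleton is a $\mathcal P$-class.
   Context: Banach spaces are real or complex. $\operatorname{dens}X$ is the smallest cardinality of a dense subset of $X$; a cardinal is identified with the first ordinal of that cardinality. A projectional resolution of the identity (PRI) on a non-separable Banach space $X$ with $\kappa=\operatorname{dens}X$ is a transfinite sequence $(P_\alpha)_{\alpha\le\kappa}$ of linear projections on $X$ such that: (i) $P_0=0$, $P_\kappa=I$; (ii) $\|P_\alpha\|=1$ for $0<\alpha\le\kappa$; (iii) $\operatorname{dens}P_\alpha X\le\max\{\aleph_0,\operatorname{card}\alpha\}$ for $\alpha\le\kappa$; (iv) $P_\alpha P_\beta=P_\beta P_\alpha=P_\alpha$ for $\alpha\le\beta\le\kappa$; (v) $P_\lambda X=\overline{\bigcup_{\alpha<\lambda}P_\alpha X}$ for limit $\lambda\le\kappa$. A class $\mathcal C$ of Banach spaces is a $\mathcal P$-class if for every non-separable $X\in\mathcal C$ there is a PRI $(P_\alpha)_{\alpha\le\kappa}$ on $X$ such that $(P_{\alpha+1}-P_\alpha)X\in\mathcal C$ for each $\alpha<\kappa$. A projectional skeleton on a Banach space $X$ is a family $(P_s)_{s\in\Gamma}$ of bounded linear projections on $X$ indexed by an up-directed partially ordered set $\Gamma$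 such that: (i) $P_sX$ is separable for $s\in\Gamma$; (ii) $P_sP_t=P_tP_s=P_s$ whenever $s\le t$; (iii) if $(s_n)$ is an increasing (i.e. non-decreasing) sequence in $\Gamma$, then $s=\sup_n s_n$ exists in $\Gamma$ and $P_sX=\overline{\bigcup_nP_{s_n}X}$; (iv) $X=\bigcup_{s\in\Gamma}P_sX$. A $1$-projectional skeleton is a projectional skeleton consisting of norm one projections. *)

theory Defs
  imports "HOL-Analysis.Analysis"
begin

unbundle cardinal_syntax

section \<open>Normed spaces over the real or complex scalars\<close>

text \<open>
  By the Gelfand--Mazur theorem, the instances of \<^class>\<open>real_normed_field\<close> are, up to
  isomorphism, the real and the complex numbers. Hence a normed space over \<open>'k\<close> is a real or a
  complex normed space; its underlying real structure is the one given by the type class of \<open>'a\<close>.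
\<close>

locale normed_space_over = vector_space smul
  for smul :: "'k::real_normed_field \<Rightarrow> 'a::real_normed_vector \<Rightarrow> 'a" +
  assumes norm_scale: "norm (smul c x) = norm c * norm x"
    and scale_of_real: "smul (of_real r) x = r *\<^sub>R x"

lemma normed_space_over_real:
  "normed_space_over (scaleR :: real \<Rightarrow> 'a::real_normed_vector \<Rightarrow> 'a)"
  by unfold_locales (auto simp: algebra_simps)

lemma normed_space_over_complex:
  "normed_space_over ((*) :: complex \<Rightarrow> complex \<Rightarrow> complex)"
  by unfold_locales (auto simp: algebra_simps norm_mult scaleR_conv_of_real)

text \<open>
  Banach spaces are closed linear subspaces of a type of class \<^class>\<open>banach\<close> (possibly the whole
  type), so that ranges of projections are Banach spaces in the same sense.
\<close>

definition banach_space :: "('k::real_normed_field \<Rightarrow> 'a::banach \<Rightarrow> 'a) \<Rightarrow> 'a set \<Rightarrow> bool" where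
  "banach_space smul X \<longleftrightarrow> normed_space_over smul \<and> module.subspace smul X \<and> closed X"

abbreviation separable :: "'a::topological_space set \<Rightarrow> bool" where
  "separable X \<equiv> separable_space (top_of_set X)"


section \<open>Density character\<close>

definition dense_in :: "'a::topological_space set \<Rightarrow> 'a set \<Rightarrow> bool" where
  "dense_in X D \<longleftrightarrow> D \<subseteq> X \<and> X \<subseteq> closure D"

definition dens :: "'a::topological_space set \<Rightarrow> 'a rel" where
  "dens X = |SOME D. dense_in X D \<and> (\<forall>E. dense_in X E \<longrightarrow> |D| \<le>o |E| )|"

lemma dens_attained:
  "\<exists>D. dense_in X D \<and> (\<forall>E. dense_in X E \<longrightarrow> |D| \<le>o |E| ) \<and> dens X = |D|"
proof -
  have "dense_in X X"
    by (simp add: dense_in_def closure_subset)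
  then have "card_of ` {D. dense_in X D} \<noteq> {}" by auto
  moreover have "\<forall>r \<in> card_of ` {D. dense_in X D}. Card_order r"
    by (auto simp: card_of_Card_order)
  ultimately have "\<exists>r \<in> card_of ` {D. dense_in X D}. \<forall>r' \<in> card_of ` {D. dense_in X D}. r \<le>o r'"
    by (rule exists_minim_Card_order)
  then have ex: "\<exists>D. dense_in X D \<and> (\<forall>E. dense_in X E \<longrightarrow> |D| \<le>o |E| )"
    by (simp add: Bex_def image_iff) blast
  show ?thesis
    unfolding dens_def
    by (rule exI, rule conjI[OF conjunct1 conjI[OF conjunct2 refl]]) (rule someI_ex[OF ex])+
qed


section \<open>Ordinals up to a cardinal\<close>

text \<open>
  The cardinal \<open>\<kappa>\<close> is a well-order of minimal type on its field. An ordinal \<open>\<alpha> \<le> \<kappa>\<close> is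
  represented by the initial segment of \<open>\<kappa>\<close> of order type \<open>\<alpha>\<close>, i.e. as the set of its predecessors.
  Thus \<open>0\<close> is \<open>{}\<close>, the ordinal \<open>\<kappa>\<close> itself is \<open>Field \<kappa>\<close>, the order is inclusion, and the
  cardinality of \<open>\<alpha>\<close> is \<open>|\<alpha>|\<close>. The ordinals \<open>\<alpha> < \<kappa>\<close> are exactly the sets \<open>underS \<kappa> a\<close> with
  \<open>a \<in> Field \<kappa>\<close>, and then \<open>\<alpha> + 1\<close> is \<open>under \<kappa> a\<close>.
\<close>

definition ordinals_upto :: "'b rel \<Rightarrow> 'b set set" where
  "ordinals_upto \<kappa> = {\<alpha>. ofilter \<kappa> \<alpha>}"

definition limit_ordinal :: "'b rel \<Rightarrow> 'b set \<Rightarrow> bool" where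
  "limit_ordinal \<kappa> \<alpha> \<longleftrightarrow>
     \<alpha> \<in> ordinals_upto \<kappa> \<and> \<alpha> \<noteq> {} \<and> (\<forall>a \<in> Field \<kappa>. \<alpha> \<noteq> under \<kappa> a)"


section \<open>Projections\<close>

text \<open>
  Operators on \<open>X\<close> are functions on the ambient type of which only the values on \<open>X\<close> matter.
  The operator norm below is meaningful only for operators that are bounded on \<open>X\<close>; at \<open>x = 0\<close>
  the quotient is \<open>0\<close> by the convention for division.
\<close>

definition bounded_projection ::
    "('k::real_normed_field \<Rightarrow> 'a::banach \<Rightarrow> 'a) \<Rightarrow> 'a set \<Rightarrow> ('a \<Rightarrow> 'a) \<Rightarrow> bool" where
  "bounded_projection smul X P \<longleftrightarrow>
     P ` X \<subseteq> X \<and>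
     (\<forall>x\<in>X. \<forall>y\<in>X. P (x + y) = P x + P y) \<and>
     (\<forall>c. \<forall>x\<in>X. P (smul c x) = smul c (P x)) \<and>
     (\<forall>x\<in>X. P (P x) = P x) \<and>
     (\<exists>K. \<forall>x\<in>X. norm (P x) \<le> K * norm x)"

definition opnorm_on :: "'a::real_normed_vector set \<Rightarrow> ('a \<Rightarrow> 'a) \<Rightarrow> real" where
  "opnorm_on X P = (SUP x\<in>X. norm (P x) / norm x)"


section \<open>Projectional resolutions of the identity\<close>

definition PRI ::
    "('k::real_normed_field \<Rightarrow> 'a::banach \<Rightarrow> 'a) \<Rightarrow> 'a set \<Rightarrow> ('a set \<Rightarrow> 'a \<Rightarrow> 'a) \<Rightarrow> bool" where
  "PRI smul X P \<longleftrightarrow>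
     (let \<kappa> = dens X; Ords = ordinals_upto \<kappa> in
       (\<forall>\<alpha>\<in>Ords. bounded_projection smul X (P \<alpha>)) \<and>
       (\<forall>x\<in>X. P {} x = 0) \<and> (\<forall>x\<in>X. P (Field \<kappa>) x = x) \<and>
       (\<forall>\<alpha>\<in>Ords. \<alpha> \<noteq> {} \<longrightarrow> opnorm_on X (P \<alpha>) = 1) \<and>
       (\<forall>\<alpha>\<in>Ords. dens (P \<alpha> ` X) \<le>o natLeq \<or> dens (P \<alpha> ` X) \<le>o |\<alpha>| ) \<and>
       (\<forall>\<alpha>\<in>Ords. \<forall>\<beta>\<in>Ords. \<alpha> \<subseteq> \<beta> \<longrightarrow>
          (\<forall>x\<in>X. P \<alpha> (P \<beta> x) = P \<alpha> x \<and> P \<beta> (P \<alpha> x) = P \<alpha> x)) \<and>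
       (\<forall>\<mu>. limit_ordinal \<kappa> \<mu> \<longrightarrow> P \<mu> ` X = closure (\<Union>\<alpha>\<in>{\<alpha>\<in>Ords. \<alpha> \<subset> \<mu>}. P \<alpha> ` X)))"

definition PRI_piece ::
    "'a::banach set \<Rightarrow> ('a set \<Rightarrow> 'a \<Rightarrow> 'a) \<Rightarrow> 'a \<Rightarrow> 'a set" where
  "PRI_piece X P a = (\<lambda>x. P (under (dens X) a) x - P (underS (dens X) a) x) ` X"

definition P_class ::
    "('k::real_normed_field \<Rightarrow> 'a::banach \<Rightarrow> 'a) \<Rightarrow> ('a set \<Rightarrow> bool) \<Rightarrow> bool" where
  "P_class smul \<C> \<longleftrightarrow>
     (\<forall>X. banach_space smul X \<and> \<not> separable X \<and> \<C> X \<longrightarrow>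
        (\<exists>P. PRI smul X P \<and> (\<forall>a \<in> Field (dens X). \<C> (PRI_piece X P a))))"


section \<open>Projectional skeletons\<close>

definition up_directed :: "'i set \<Rightarrow> 'i rel \<Rightarrow> bool" where
  "up_directed \<Gamma> le \<longleftrightarrow>
     \<Gamma> \<noteq> {} \<and> (\<forall>s\<in>\<Gamma>. \<forall>t\<in>\<Gamma>. \<exists>u\<in>\<Gamma>. (s, u) \<in> le \<and> (t, u) \<in> le)"

definition is_sup_seq :: "'i set \<Rightarrow> 'i rel \<Rightarrow> (nat \<Rightarrow> 'i) \<Rightarrow> 'i \<Rightarrow> bool" where
  "is_sup_seq \<Gamma> le \<sigma> s \<longleftrightarrow>
     s \<in> \<Gamma> \<and> (\<forall>n. (\<sigma> n, s) \<in> le) \<and> (\<forall>u\<in>\<Gamma>. (\<forall>n. (\<sigma> n, u) \<in> le) \<longrightarrow> (s, u) \<in> le)"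

definition projectional_skeleton ::
    "('k::real_normed_field \<Rightarrow> 'a::banach \<Rightarrow> 'a) \<Rightarrow> 'a set \<Rightarrow> 'i set \<Rightarrow> 'i rel \<Rightarrow> ('i \<Rightarrow> 'a \<Rightarrow> 'a) \<Rightarrow> bool"
  where
  "projectional_skeleton smul X \<Gamma> le P \<longleftrightarrow>
     banach_space smul X \<and>
     partial_order_on \<Gamma> le \<and> up_directed \<Gamma> le \<and>
     (\<forall>s\<in>\<Gamma>. bounded_projection smul X (P s)) \<and>
     (\<forall>s\<in>\<Gamma>. separable (P s ` X)) \<and>
     (\<forall>s t. (s, t) \<in> le \<longrightarrow> (\<forall>x\<in>X. P s (P t x) = P s x \<and> P t (P s x) = P s x)) \<and>
     (\<forall>\<sigma>. (\<forall>n. \<sigma> n \<in> \<Gamma> \<and> (\<sigma> n, \<sigma> (Suc n)) \<in> le) \<longrightarrow>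
        (\<exists>s. is_sup_seq \<Gamma> le \<sigma> s \<and> P s ` X = closure (\<Union>n. P (\<sigma> n) ` X))) \<and>
     X = (\<Union>s\<in>\<Gamma>. P s ` X)"

definition one_projectional_skeleton ::
    "('k::real_normed_field \<Rightarrow> 'a::banach \<Rightarrow> 'a) \<Rightarrow> 'a set \<Rightarrow> 'i set \<Rightarrow> 'i rel \<Rightarrow> ('i \<Rightarrow> 'a \<Rightarrow> 'a) \<Rightarrow> bool"
  where
  "one_projectional_skeleton smul X \<Gamma> le P \<longleftrightarrow>
     projectional_skeleton smul X \<Gamma> le P \<and> (\<forall>s\<in>\<Gamma>. opnorm_on X (P s) = 1)"

text \<open>
  Since one cannot quantify over types, the type \<open>'i\<close> from which index sets are taken is a
  parameter. The index set is an arbitrary subset of \<open>'i\<close> with an arbitrary partial order on it.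
\<close>

definition admits_one_skeleton ::
    "'i itself \<Rightarrow> ('k::real_normed_field \<Rightarrow> 'a::banach \<Rightarrow> 'a) \<Rightarrow> 'a set \<Rightarrow> bool" where
  "admits_one_skeleton (_ :: 'i itself) smul X \<longleftrightarrow>
     (\<exists>(\<Gamma> :: 'i set) le P. one_projectional_skeleton smul X \<Gamma> le P)"

end

theory Submission
  imports Defs "HOL-Algebra.Free_Abelian_Groups" "HOL-Library.Countable_Set_Type"
begin

text \<open>
  Let \<open>(P\<^sub>s)\<close> be a 1-projectional skeleton on \<open>X\<close>, indexed by \<open>\<Gamma>\<close>. Since the \<open>P\<^sub>s\<close> are uniformly
  bounded, \<open>P\<^sub>s\<^sub>n x\<close> converges to \<open>P\<^sub>s x\<close> whenever \<open>s\<close> is the supremum of an increasing sequence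
  \<open>(s\<^sub>n)\<close>. Call a non-empty directed subset \<open>L\<close> of \<open>\<Gamma>\<close> that contains the suprema of its increasing sequences
  sigma-directed. Countable subsets of \<open>L\<close> have upper bounds in \<open>L\<close>, and together with the
  convergence this shows that for each \<open>x\<close> the net \<open>P\<^sub>s x\<close>, \<open>s \<in> L\<close>, is eventually constant
  (\<open>eventually_constant\<close>). Its eventual value is \<open>P\<^sub>L x\<close> for a projection \<open>P\<^sub>L\<close> of norm at most one
  (\<open>lim_proj\<close>) whose range is the union of the ranges of the \<open>P\<^sub>s\<close> with \<open>s \<in> L\<close>; the identities
  \<open>P\<^sub>L P\<^sub>M = P\<^sub>M P\<^sub>L = P\<^sub>L\<close> for \<open>L \<subseteq> M\<close> are immediate.

  The closure of a directed set \<open>T\<close> under suprema of sequences is sigma-directed, and the ranges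
  indexed by \<open>T\<close> are dense in the range of its projection. Choosing indices for the finite subsets
  of \<open>X\<close> monotonically, one obtains from each \<open>A \<subseteq> X\<close> a directed set with at most as many
  elements as \<open>A\<close> has finite subsets, hence a projection \<open>proj_on A\<close> that fixes \<open>A\<close> and whose range has density at most
  \<open>max(\<aleph>\<^sub>0, |A| )\<close>. It increases with \<open>A\<close>, continuously along unions of chains. Applied to the initial
  segments of a dense set of cardinality \<open>\<kappa>\<close>, well-ordered in type \<open>\<kappa>\<close>, this is already a
  projectional resolution of the identity, except that some steps may be trivial.
  A trivial difference \<open>{0}\<close> has no 1-projectional skeleton, as no operator on it has norm one.
  So each step \<open>a\<close> also adjoins a vector \<open>f a\<close> outside the range reached before \<open>a\<close>, which exists
  because the density of that range is smaller than \<open>\<kappa>\<close>.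

  It remains to find a skeleton on \<open>Y = (P\<^sub>M - P\<^sub>L)X = P\<^sub>M X \<inter> ker P\<^sub>L\<close> for \<open>L \<subseteq> M\<close>
  (\<open>difference_admits_one_skeleton\<close>). The restrictions of those \<open>P\<^sub>u\<close>, \<open>u \<in> M\<close>, that map \<open>Y\<close> into
  itself and do not vanish on \<open>Y\<close> will do. The point is that such \<open>u\<close> are cofinal in \<open>M\<close>, although
  \<open>P\<^sub>u\<close> and \<open>P\<^sub>L\<close> need not commute. Since \<open>P\<^sub>u X\<close> is separable, \<open>P\<^sub>L\<close> agrees on it with \<open>P\<^sub>t\<close> for some \<open>t \<in> L\<close>.
  Iterating this and passing to suprema yields arbitrarily large \<open>w \<in> M\<close> and \<open>t \<in> L\<close> with \<open>t \<le> w\<close> such that \<open>P\<^sub>L\<close>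
  agrees with \<open>P\<^sub>t\<close> on \<open>P\<^sub>w X\<close>. Then \<open>P\<^sub>L P\<^sub>w = P\<^sub>t P\<^sub>w = P\<^sub>t = P\<^sub>t P\<^sub>L\<close>, so \<open>P\<^sub>w\<close> preserves the kernel of
  \<open>P\<^sub>L\<close> (\<open>cofinal_commuting\<close>).
\<close>

section \<open>Dense subsets and density character\<close>

lemma dens_least:
  assumes "dense_in X E"
  shows "dens X \<le>o |E|"
  using dens_attained[of X] assms by auto

lemma separable_iff_countable_dense:
  "separable X \<longleftrightarrow> (\<exists>C. countable C \<and> dense_in X C)"
proof -
  have "Abstract_Topology.closure_of (top_of_set X) C = X \<longleftrightarrow> X \<subseteq> closure C" if "C \<subseteq> X" for C
    using that by (auto simp: closure_of_subtopology Int_absorb1)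
  then show ?thesis
    by (auto simp: separable_space_def dense_in_def)
qed

lemma separable_subset:
  fixes X :: "'a::metric_space set"
  assumes "separable X" and "Y \<subseteq> X"
  shows "separable Y"
proof -
  obtain C where C: "countable C" "X \<subseteq> closure C"
    using assms(1) by (auto simp: separable_iff_countable_dense dense_in_def)
  \<comment> \<open>A dense set of the larger space need not meet the smaller one, so its points are replaced by
    nearby points of \<open>Y\<close>. Where there is no such point the choice is arbitrary, hence the
    intersection with \<open>Y\<close>.\<close>
  define pick where "pick c n = (SOME y. y \<in> Y \<and> dist y c < 1 / real (Suc n))" for c n
  define E where "E = (\<lambda>(c, n). pick c n) ` (C \<times> UNIV) \<inter> Y"
  have "y \<in> closure E" if y: "y \<in> Y" for y
    unfolding closure_approachable
  proof (intro allI impI)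
    fix e :: real assume "e > 0"
    then obtain n where n: "1 / real (Suc n) < e / 2"
      using nat_approx_posE[of "e / 2"] by auto
    have "y \<in> closure C" using y assms(2) C(2) by auto
    then obtain c where c: "c \<in> C" "dist c y < 1 / real (Suc n)"
      by (auto simp: closure_approachable dest!: spec[of _ "1 / real (Suc n)"])
    have "pick c n \<in> Y \<and> dist (pick c n) c < 1 / real (Suc n)"
      unfolding pick_def
      by (rule someI[of "\<lambda>y. y \<in> Y \<and> dist y c < 1 / real (Suc n)" y]) (use y c(2) in \<open>simp add: dist_commute\<close>)
    then show "\<exists>z\<in>E. dist z y < e"
      using c n dist_triangle[of "pick c n" y c] unfolding E_def
      by (intro bexI[of _ "pick c n"]) (auto intro!: image_eqI[of _ _ "(c, n)"])
  qed
  moreover have "countable E" "E \<subseteq> Y"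
    using C(1) by (auto simp: E_def)
  ultimately show ?thesis
    by (auto simp: separable_iff_countable_dense dense_in_def)
qed

lemma card_of_Un_image_le:
  assumes "infinite (U \<union> f ` U)"
  shows "|U \<union> f ` U| \<le>o |U|"
proof -
  have "infinite U" using assms by auto
  then show ?thesis
    by (intro card_of_Un_ordLeq_infinite) (auto simp: card_of_image)
qed

section \<open>Projections of a 1-projectional skeleton\<close>

locale one_skeleton =
  fixes smul :: "'k::real_normed_field \<Rightarrow> 'a::banach \<Rightarrow> 'a"
    and X :: "'a set" and \<Gamma> :: "'i set" and le :: "'i rel" and P :: "'i \<Rightarrow> 'a \<Rightarrow> 'a"
  assumes skeleton: "one_projectional_skeleton smul X \<Gamma> le P"

sublocale one_skeleton \<subseteq> S: normed_space_over smul
  using skeleton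
  by (simp add: one_projectional_skeleton_def projectional_skeleton_def banach_space_def)

context one_skeleton
begin

abbreviation leq (infix "\<preceq>" 50) where "s \<preceq> t \<equiv> (s, t) \<in> le"

lemma skeleton_facts:
  shows subspace_X: "S.subspace X" and closed_X: "closed X"
    and le_sub: "le \<subseteq> \<Gamma> \<times> \<Gamma>" and le_refl: "s \<in> \<Gamma> \<Longrightarrow> s \<preceq> s"
    and le_trans: "r \<preceq> s \<Longrightarrow> s \<preceq> t \<Longrightarrow> r \<preceq> t"
    and le_antisym: "s \<preceq> t \<Longrightarrow> t \<preceq> s \<Longrightarrow> s = t"
    and Gamma_ne: "\<Gamma> \<noteq> {}"
    and Gamma_dir: "s \<in> \<Gamma> \<Longrightarrow> t \<in> \<Gamma> \<Longrightarrow> \<exists>u\<in>\<Gamma>. s \<preceq> u \<and> t \<preceq> u"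
    and P_proj: "s \<in> \<Gamma> \<Longrightarrow> bounded_projection smul X (P s)"
    and P_separable: "s \<in> \<Gamma> \<Longrightarrow> separable (P s ` X)"
    and P_le1: "s \<preceq> t \<Longrightarrow> x \<in> X \<Longrightarrow> P s (P t x) = P s x"
    and P_le2: "s \<preceq> t \<Longrightarrow> x \<in> X \<Longrightarrow> P t (P s x) = P s x"
    and sup_ex: "(\<And>n. \<sigma> n \<in> \<Gamma>) \<Longrightarrow> (\<And>n. \<sigma> n \<preceq> \<sigma> (Suc n)) \<Longrightarrow>
        \<exists>s. is_sup_seq \<Gamma> le \<sigma> s \<and> P s ` X = closure (\<Union>n. P (\<sigma> n) ` X)"
    and X_eq: "X = (\<Union>s\<in>\<Gamma>. P s ` X)"
    and P_opnorm: "s \<in> \<Gamma> \<Longrightarrow> opnorm_on X (P s) = 1"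
  using skeleton unfolding one_projectional_skeleton_def projectional_skeleton_def banach_space_def
    partial_order_on_def preorder_on_def refl_on_def up_directed_def
  by (auto dest: antisymD elim: transE)

lemma le_Gamma: "s \<preceq> t \<Longrightarrow> s \<in> \<Gamma> \<and> t \<in> \<Gamma>"
  using le_sub by auto

lemma zero_X: "0 \<in> X" and add_X: "x \<in> X \<Longrightarrow> y \<in> X \<Longrightarrow> x + y \<in> X"
  and diff_X: "x \<in> X \<Longrightarrow> y \<in> X \<Longrightarrow> x - y \<in> X" and smul_X: "x \<in> X \<Longrightarrow> smul c x \<in> X"
  using S.subspace_0 S.subspace_add S.subspace_diff S.subspace_scale subspace_X by blast+

end

text \<open>
  The norm is attained at any non-zero vector of the range, with ratio \<open>1\<close>. Some such vector is
  indispensable: every operator on \<open>{0}\<close> has norm \<open>0\<close>.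
\<close>

lemma opnorm_projection_eq_1:
  assumes "\<And>x. x \<in> Y \<Longrightarrow> Q x \<in> Y" "\<And>x. x \<in> Y \<Longrightarrow> Q (Q x) = Q x"
    and "\<And>x. x \<in> Y \<Longrightarrow> norm (Q x) \<le> norm x" and "x \<in> Y" and "Q x \<noteq> 0"
  shows "opnorm_on Y Q = 1"
proof (unfold opnorm_on_def, rule cSup_eq_maximum)
  show "1 \<in> (\<lambda>x. norm (Q x) / norm x) ` Y"
    using assms by (intro image_eqI[of _ _ "Q x"]) auto
  show "r \<le> 1" if "r \<in> (\<lambda>x. norm (Q x) / norm x) ` Y" for r
    using that assms(3) by (auto simp: divide_le_eq_1)
qed

lemma bounded_projection_norm_le:
  assumes "bounded_projection smul X Q" and "opnorm_on X Q = 1" and "x \<in> X"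
  shows "norm (Q x) \<le> norm x"
proof -
  obtain K where K: "\<forall>x\<in>X. norm (Q x) \<le> K * norm x"
    using assms(1) by (auto simp: bounded_projection_def)
  have "norm (Q x) / norm x \<le> max K 0" if "x \<in> X" for x
    using K that by (cases "x = 0") (auto simp: divide_le_eq max_mult_distrib_right)
  then have "bdd_above ((\<lambda>x. norm (Q x) / norm x) ` X)"
    by (auto simp: bdd_above_def)
  then have "norm (Q x) / norm x \<le> 1"
    using assms(2,3) cSUP_upper unfolding opnorm_on_def by metis
  moreover have "x = 0 \<Longrightarrow> norm (Q x) \<le> 0"
    using K assms(3) by auto
  ultimately show ?thesis
    by (cases "x = 0") (auto simp: divide_le_eq_1)
qed

context one_skeleton
begin

lemma
  assumes "s \<in> \<Gamma>"
  shows P_X: "x \<in> X \<Longrightarrow> P s x \<in> X"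
    and P_add: "x \<in> X \<Longrightarrow> y \<in> X \<Longrightarrow> P s (x + y) = P s x + P s y"
    and P_smul: "x \<in> X \<Longrightarrow> P s (smul c x) = smul c (P s x)"
    and P_idem: "x \<in> X \<Longrightarrow> P s (P s x) = P s x"
    and P_norm: "x \<in> X \<Longrightarrow> norm (P s x) \<le> norm x"
  using P_proj[OF assms] bounded_projection_norm_le[OF P_proj P_opnorm] assms
  by (auto simp: bounded_projection_def)

lemma P_diff:
  assumes "s \<in> \<Gamma>" "x \<in> X" "y \<in> X"
  shows "P s (x - y) = P s x - P s y"
  using P_add[OF assms(1) diff_X[OF assms(2,3)] assms(3)] by (simp add: algebra_simps)

lemma P_range: "s \<in> \<Gamma> \<Longrightarrow> P s ` X = {x\<in>X. P s x = x}"
  by (auto simp: P_X P_idem) (metis imageI)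

lemma fixed_mono: "s \<preceq> t \<Longrightarrow> x \<in> X \<Longrightarrow> P s x = x \<Longrightarrow> P t x = x"
  using P_le2 by metis

lemma sup_unique: "is_sup_seq \<Gamma> le \<sigma> s \<Longrightarrow> is_sup_seq \<Gamma> le \<sigma> t \<Longrightarrow> s = t"
  by (auto simp: is_sup_seq_def intro: le_antisym)

lemma le_sup: "a \<preceq> \<sigma> n \<Longrightarrow> is_sup_seq \<Gamma> le \<sigma> s \<Longrightarrow> a \<preceq> s"
  using le_trans[of a "\<sigma> n" s] by (simp add: is_sup_seq_def)

lemma sup_range:
  assumes "\<And>n. \<sigma> n \<preceq> \<sigma> (Suc n)" and "is_sup_seq \<Gamma> le \<sigma> s"
  shows "P s ` X = closure (\<Union>n. P (\<sigma> n) ` X)"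
  using sup_ex[of \<sigma>] sup_unique assms le_Gamma by metis

lemma seq_mono:
  assumes "\<And>n. \<sigma> n \<preceq> \<sigma> (Suc n)" and "m \<le> n"
  shows "\<sigma> m \<preceq> \<sigma> n"
  using assms(2)
proof (induction n rule: dec_induct)
  case base
  show ?case using le_refl le_Gamma[OF assms(1)[of m]] by blast
next
  case (step n)
  then show ?case using le_trans[OF step.IH assms(1)] by blast
qed

text \<open>
  \<open>P\<^sub>s x\<close> is approximated by vectors \<open>y\<close> that \<open>P\<^sub>\<sigma>\<^sub>n\<close> fixes for all large \<open>n\<close>. As \<open>P\<^sub>\<sigma>\<^sub>n P\<^sub>s = P\<^sub>\<sigma>\<^sub>n\<close> and
  the norms are bounded by one, \<open>P\<^sub>\<sigma>\<^sub>n x\<close> is then as close to \<open>y\<close> as \<open>P\<^sub>s x\<close> is.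
\<close>

lemma sup_tendsto:
  assumes inc: "\<And>n. \<sigma> n \<preceq> \<sigma> (Suc n)" and sup: "is_sup_seq \<Gamma> le \<sigma> s" and x: "x \<in> X"
  shows "(\<lambda>n. P (\<sigma> n) x) \<longlonglongrightarrow> P s x"
proof (rule metric_LIMSEQ_I)
  fix e :: real assume e: "e > 0"
  have s: "s \<in> \<Gamma>" and le: "\<sigma> n \<preceq> s" for n
    using sup by (auto simp: is_sup_seq_def)
  have G: "\<sigma> n \<in> \<Gamma>" for n using inc le_Gamma by blast
  have "P s x \<in> closure (\<Union>n. P (\<sigma> n) ` X)"
    using sup_range[OF inc sup] x by blast
  then obtain y where "y \<in> (\<Union>n. P (\<sigma> n) ` X)" and d: "dist y (P s x) < e / 2"
    using e unfolding closure_approachable by (meson half_gt_zero)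
  then obtain N where y: "y \<in> X" "P (\<sigma> N) y = y"
    using P_X[OF G] P_idem[OF G] by blast
  show "\<exists>N. \<forall>n\<ge>N. dist (P (\<sigma> n) x) (P s x) < e"
  proof (intro exI allI impI)
    fix n assume "N \<le> n"
    then have "P (\<sigma> n) y = y"
      using fixed_mono[OF seq_mono[of \<sigma>, OF inc \<open>N \<le> n\<close>]] y by blast
    then have "P (\<sigma> n) (P s x - y) = P (\<sigma> n) x - y"
      using P_diff[OF G] P_X[OF s x] y(1) P_le1[OF le x] by simp
    then have "norm (P (\<sigma> n) x - y) \<le> norm (P s x - y)"
      using P_norm[OF G diff_X[OF P_X[OF s x] y(1)]] by metis
    then show "dist (P (\<sigma> n) x) (P s x) < e"
      using d dist_triangle[of "P (\<sigma> n) x" "P s x" y] by (simp add: dist_norm norm_minus_commute)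
  qed
qed

lemma sup_fixed:
  assumes inc: "\<And>n. \<sigma> n \<preceq> \<sigma> (Suc n)" and sup: "is_sup_seq \<Gamma> le \<sigma> s" and x: "x \<in> X"
    and C: "closed C" and ev: "eventually (\<lambda>n. P (\<sigma> n) x \<in> C) sequentially"
  shows "P s x \<in> C"
  using Lim_in_closed_set[OF C ev _ sup_tendsto[OF inc sup x]] by simp

section \<open>Directed sets that are closed under suprema of sequences\<close>

definition directed :: "'i set \<Rightarrow> bool" where
  "directed T \<longleftrightarrow> T \<subseteq> \<Gamma> \<and> (\<forall>s\<in>T. \<forall>t\<in>T. \<exists>u\<in>T. s \<preceq> u \<and> t \<preceq> u)"

definition sup_closed :: "'i set \<Rightarrow> bool" where
  "sup_closed L \<longleftrightarrow> (\<forall>\<sigma> s. (\<forall>n. \<sigma> n \<in> L \<and> \<sigma> n \<preceq> \<sigma> (Suc n)) \<longrightarrow> is_sup_seq \<Gamma> le \<sigma> s \<longrightarrow> s \<in> L)"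

abbreviation sigma_directed :: "'i set \<Rightarrow> bool" where
  "sigma_directed L \<equiv> directed L \<and> sup_closed L"

lemma sup_closedD:
  "sup_closed L \<Longrightarrow> (\<And>n. \<sigma> n \<in> L) \<Longrightarrow> (\<And>n. \<sigma> n \<preceq> \<sigma> (Suc n)) \<Longrightarrow> is_sup_seq \<Gamma> le \<sigma> s \<Longrightarrow> s \<in> L"
  unfolding sup_closed_def by blast

lemma directedD: "directed T \<Longrightarrow> s \<in> T \<Longrightarrow> t \<in> T \<Longrightarrow> \<exists>u\<in>T. s \<preceq> u \<and> t \<preceq> u"
  unfolding directed_def by blast

lemma sup_exists:
  assumes "\<And>n. \<sigma> n \<preceq> \<sigma> (Suc n)"
  obtains s where "is_sup_seq \<Gamma> le \<sigma> s"
  using sup_ex[of \<sigma>] assms le_Gamma by metis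

text \<open>
  A countable subset of a directed set need not have an upper bound there. An increasing
  sequence that dominates it is the substitute, and its supremum is an upper bound in the closure.
\<close>

lemma directed_cofinal_seq:
  assumes T: "directed T" "T \<noteq> {}" and A: "countable A" "A \<subseteq> T"
  obtains \<sigma> where "\<And>n. \<sigma> n \<in> T" "\<And>n. \<sigma> n \<preceq> \<sigma> (Suc n)" "\<And>a. a \<in> A \<Longrightarrow> \<exists>n. a \<preceq> \<sigma> n"
proof -
  obtain a :: "nat \<Rightarrow> 'i" where a: "range a \<subseteq> T" "A \<subseteq> range a"
  proof (cases "A = {}")
    case True then show ?thesis using that[of "\<lambda>_. SOME t. t \<in> T"] T(2) some_in_eq by auto
  next
    case False then show ?thesis using that[of "from_nat_into A"] A by (simp add: range_from_nat_into)
  qed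
  have "\<exists>\<sigma>. \<forall>n. (\<sigma> n \<in> T \<and> a n \<preceq> \<sigma> n) \<and> \<sigma> n \<preceq> \<sigma> (Suc n)"
  proof (rule dependent_nat_choice)
    show "\<exists>x. x \<in> T \<and> a 0 \<preceq> x" using directedD[OF T(1)] a(1) by blast
    show "\<exists>y. (y \<in> T \<and> a (Suc n) \<preceq> y) \<and> x \<preceq> y" if "x \<in> T \<and> a n \<preceq> x" for x n
      using directedD[OF T(1), of "a (Suc n)" x] a(1) that by blast
  qed
  then show ?thesis using that a(2) by blast
qed

lemma countable_bound:
  assumes L: "directed L" "sup_closed L" "L \<noteq> {}" and A: "countable A" "A \<subseteq> L"
  obtains u where "u \<in> L" "\<And>a. a \<in> A \<Longrightarrow> a \<preceq> u"
proof -
  obtain \<sigma> where \<sigma>: "\<And>n. \<sigma> n \<in> L" "\<And>n. \<sigma> n \<preceq> \<sigma> (Suc n)" "\<And>a. a \<in> A \<Longrightarrow> \<exists>n. a \<preceq> \<sigma> n"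
    using directed_cofinal_seq[OF L(1,3) A] by metis
  obtain u where u: "is_sup_seq \<Gamma> le \<sigma> u" using sup_exists \<sigma>(2) by blast
  have "u \<in> L" using sup_closedD[OF L(2) \<sigma>(1,2) u] .
  moreover have "a \<preceq> u" if "a \<in> A" for a
    using \<sigma>(3)[OF that] le_sup[OF _ u] by blast
  ultimately show ?thesis by (rule that)
qed

lemma sigma_directed_Gamma: "directed \<Gamma>" "sup_closed \<Gamma>"
  using Gamma_dir by (auto simp: directed_def sup_closed_def is_sup_seq_def)

inductive_set sup_hull :: "'i set \<Rightarrow> 'i set" for T where
  base: "s \<in> T \<Longrightarrow> s \<in> sup_hull T"
| sup: "(\<And>n. \<sigma> n \<in> sup_hull T) \<Longrightarrow> (\<And>n. \<sigma> n \<preceq> \<sigma> (Suc n)) \<Longrightarrow> is_sup_seq \<Gamma> le \<sigma> s \<Longrightarrow> s \<in> sup_hull T"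

lemma sup_hull_least: "T \<subseteq> L \<Longrightarrow> sup_closed L \<Longrightarrow> sup_hull T \<subseteq> L"
proof
  fix s assume "T \<subseteq> L" "sup_closed L" "s \<in> sup_hull T"
  from this(3,1,2) show "s \<in> L" by induction (auto intro: sup_closedD)
qed

lemma sup_closed_hull: "sup_closed (sup_hull T)"
  unfolding sup_closed_def by (blast intro: sup_hull.sup)

lemma sup_hull_mono: "S \<subseteq> T \<Longrightarrow> sup_hull S \<subseteq> sup_hull T"
  using sup_hull_least sup_closed_hull sup_hull.base by (metis subset_iff)

lemma sup_hull_empty: "sup_hull {} = {}"
proof -
  have "sup_closed {}" by (auto simp: sup_closed_def)
  then show ?thesis using sup_hull_least by blast
qed

text \<open>
  This describes an element of the closure by countably many elements of \<open>T\<close> itself, so that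
  directedness of the closure can be reduced to that of \<open>T\<close>.
\<close>

lemma sup_hull_countably_dominated:
  assumes "s \<in> sup_hull T" and "T \<subseteq> \<Gamma>"
  shows "\<exists>A. countable A \<and> A \<subseteq> T \<and> (\<forall>v\<in>\<Gamma>. (\<forall>a\<in>A. a \<preceq> v) \<longrightarrow> s \<preceq> v)"
  using assms(1)
proof induction
  case (base s)
  then show ?case by (intro exI[of _ "{s}"]) auto
next
  case (sup \<sigma> s)
  then obtain A where A: "\<And>n. countable (A n)" "\<And>n. A n \<subseteq> T"
      "\<And>n v. v \<in> \<Gamma> \<Longrightarrow> \<forall>a\<in>A n. a \<preceq> v \<Longrightarrow> \<sigma> n \<preceq> v"
    by metis
  have "s \<preceq> v" if "v \<in> \<Gamma>" "\<forall>a\<in>\<Union>n. A n. a \<preceq> v" for v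
    using that sup.hyps(3) A(3)[OF that(1)] by (simp add: is_sup_seq_def)
  then show ?case
    using A(1,2) by (intro exI[of _ "\<Union>n. A n"]) auto
qed

lemma directed_sup_hull:
  assumes "directed T"
  shows "directed (sup_hull T)"
proof -
  have T: "T \<subseteq> \<Gamma>" using assms by (simp add: directed_def)
  have sub: "sup_hull T \<subseteq> \<Gamma>"
    by (rule sup_hull_least[OF T sigma_directed_Gamma(2)])
  have "\<exists>u\<in>sup_hull T. s \<preceq> u \<and> t \<preceq> u" if st: "s \<in> sup_hull T" "t \<in> sup_hull T" for s t
  proof -
    obtain A where A: "countable A" "A \<subseteq> T" "\<forall>v\<in>\<Gamma>. (\<forall>a\<in>A. a \<preceq> v) \<longrightarrow> s \<preceq> v"
      using sup_hull_countably_dominated[OF st(1) T] by blast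
    obtain B where B: "countable B" "B \<subseteq> T" "\<forall>v\<in>\<Gamma>. (\<forall>b\<in>B. b \<preceq> v) \<longrightarrow> t \<preceq> v"
      using sup_hull_countably_dominated[OF st(2) T] by blast
    have ne: "T \<noteq> {}" using st(1) sup_hull_empty by auto
    have "countable (A \<union> B)" "A \<union> B \<subseteq> T" using A B by auto
    then obtain \<sigma> where \<sigma>: "\<And>n. \<sigma> n \<in> T" "\<And>n. \<sigma> n \<preceq> \<sigma> (Suc n)" "\<And>a. a \<in> A \<union> B \<Longrightarrow> \<exists>n. a \<preceq> \<sigma> n"
      using directed_cofinal_seq[OF assms ne] by metis
    obtain u where u: "is_sup_seq \<Gamma> le \<sigma> u" using sup_exists \<sigma>(2) by blast
    have uT: "u \<in> sup_hull T" using sup_hull.sup[of \<sigma> T u] sup_hull.base \<sigma>(1,2) u by simp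
    have "a \<preceq> u" if "a \<in> A \<union> B" for a
      using \<sigma>(3)[OF that] le_sup[OF _ u] by blast
    then show ?thesis using A(3) B(3) uT sub by (intro bexI[of _ u]) auto
  qed
  then show ?thesis using sub by (auto simp: directed_def)
qed

section \<open>The projection associated with a sigma-directed set\<close>

text \<open>
  The eventual value of the net \<open>(P\<^sub>s x)\<close>, \<open>s \<in> L\<close>. For the empty set it is the zero projection, which
  is what the ordinal \<open>0\<close> in a projectional resolution calls for.
\<close>

definition lim_proj :: "'i set \<Rightarrow> 'a \<Rightarrow> 'a" where
  "lim_proj L x = (if L = {} then 0 else THE y. \<exists>t\<in>L. \<forall>u\<in>L. t \<preceq> u \<longrightarrow> P u x = y)"

text \<open>
  If the net were not Cauchy, it would oscillate along an increasing sequence, contradicting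
  the convergence to the value at its supremum. Beyond an upper bound \<open>t\<close> of countably
  many indices that witness the Cauchy property for \<open>1/n\<close>, the net cannot move any more.
\<close>

lemma eventually_constant:
  assumes L: "directed L" "sup_closed L" "L \<noteq> {}" and x: "x \<in> X"
  shows "\<exists>t\<in>L. \<forall>u\<in>L. t \<preceq> u \<longrightarrow> P u x = P t x"
proof -
  have Cauchy: "\<exists>s\<in>L. \<forall>u\<in>L. s \<preceq> u \<longrightarrow> dist (P u x) (P s x) < e" if e: "e > 0" for e
  proof (rule ccontr)
    assume "\<not> ?thesis"
    then have step: "\<exists>u. u \<in> L \<and> s \<preceq> u \<and> e \<le> dist (P u x) (P s x)" if "s \<in> L" for s
      using that by (meson not_le)
    have "\<exists>\<sigma>. \<forall>n. \<sigma> n \<in> L \<and> (\<sigma> n \<preceq> \<sigma> (Suc n) \<and> e \<le> dist (P (\<sigma> (Suc n)) x) (P (\<sigma> n) x))"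
      by (rule dependent_nat_choice) (use L(3) step in auto)
    then obtain \<sigma> where \<sigma>: "\<And>n. \<sigma> n \<preceq> \<sigma> (Suc n)" "\<And>n. e \<le> dist (P (\<sigma> (Suc n)) x) (P (\<sigma> n) x)"
      by blast
    obtain s where "is_sup_seq \<Gamma> le \<sigma> s" using sup_exists \<sigma>(1) by blast
    then have "(\<lambda>n. P (\<sigma> n) x) \<longlonglongrightarrow> P s x" using sup_tendsto[of \<sigma> s x] \<sigma>(1) x by blast
    then have "Cauchy (\<lambda>n. P (\<sigma> n) x)" by (rule LIMSEQ_imp_Cauchy)
    then obtain N where "\<And>m n. m \<ge> N \<Longrightarrow> n \<ge> N \<Longrightarrow> dist (P (\<sigma> m) x) (P (\<sigma> n) x) < e"
      using e unfolding Cauchy_def by blast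
    from this[of "Suc N" N] show False using \<sigma>(2)[of N] by simp
  qed
  have "\<forall>n. \<exists>s\<in>L. \<forall>u\<in>L. s \<preceq> u \<longrightarrow> dist (P u x) (P s x) < inverse (real (Suc n))"
    by (intro allI Cauchy) simp
  then obtain s where s: "\<And>n. s n \<in> L"
      "\<And>n u. u \<in> L \<Longrightarrow> s n \<preceq> u \<Longrightarrow> dist (P u x) (P (s n) x) < inverse (real (Suc n))"
    by metis
  have "countable (range s)" "range s \<subseteq> L" using s(1) by auto
  then obtain t where t: "t \<in> L" "\<And>a. a \<in> range s \<Longrightarrow> a \<preceq> t"
    using countable_bound[OF L] by metis
  have "P u x = P t x" if u: "u \<in> L" "t \<preceq> u" for u
  proof (rule ccontr)
    assume "P u x \<noteq> P t x"
    then obtain n where n: "inverse (real (Suc n)) < dist (P u x) (P t x) / 2"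
      using reals_Archimedean[of "dist (P u x) (P t x) / 2"] by auto
    have "s n \<preceq> t" using t(2) by blast
    then have "dist (P u x) (P (s n) x) < inverse (real (Suc n))"
      "dist (P t x) (P (s n) x) < inverse (real (Suc n))"
      using s(2) t(1) u le_trans by blast+
    then show False
      using n dist_triangle2[of "P u x" "P t x" "P (s n) x"] by simp
  qed
  then show ?thesis using t(1) by blast
qed

lemma lim_proj_empty: "lim_proj {} x = 0"
  by (simp add: lim_proj_def)

lemma lim_proj_eqI:
  assumes L: "directed L" and t: "t \<in> L" "\<And>u. u \<in> L \<Longrightarrow> t \<preceq> u \<Longrightarrow> P u x = y"
  shows "lim_proj L x = y"
proof -
  have "(THE y. \<exists>t\<in>L. \<forall>u\<in>L. t \<preceq> u \<longrightarrow> P u x = y) = y"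
  proof (rule the_equality)
    show "\<exists>t\<in>L. \<forall>u\<in>L. t \<preceq> u \<longrightarrow> P u x = y" using t by blast
    fix z assume "\<exists>t\<in>L. \<forall>u\<in>L. t \<preceq> u \<longrightarrow> P u x = z"
    then obtain t' where t': "t' \<in> L" "\<forall>u\<in>L. t' \<preceq> u \<longrightarrow> P u x = z" by blast
    obtain u where "u \<in> L" "t \<preceq> u" "t' \<preceq> u" using directedD[OF L t(1) t'(1)] by blast
    then show "z = y" using t(2) t'(2) by metis
  qed
  then show ?thesis using t(1) by (auto simp: lim_proj_def)
qed

text \<open>
  One index works for countably many vectors at once. Algebraic identities for the limit are
  thereby inherited from a single \<open>P\<^sub>t\<close>.
\<close>

lemma lim_proj_attained:
  assumes L: "directed L" "sup_closed L" "L \<noteq> {}" and C: "countable C" "C \<subseteq> X"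
  obtains t where "t \<in> L" "\<And>u x. u \<in> L \<Longrightarrow> t \<preceq> u \<Longrightarrow> x \<in> C \<Longrightarrow> P u x = lim_proj L x"
proof -
  have "\<forall>x\<in>C. \<exists>t\<in>L. \<forall>u\<in>L. t \<preceq> u \<longrightarrow> P u x = lim_proj L x"
  proof
    fix x assume "x \<in> C"
    then obtain t where t: "t \<in> L" "\<forall>u\<in>L. t \<preceq> u \<longrightarrow> P u x = P t x"
      using eventually_constant[OF L] C(2) by blast
    then have "lim_proj L x = P t x" by (intro lim_proj_eqI[OF L(1)]) auto
    then show "\<exists>t\<in>L. \<forall>u\<in>L. t \<preceq> u \<longrightarrow> P u x = lim_proj L x" using t by auto
  qed
  then obtain \<tau> where \<tau>: "\<And>x. x \<in> C \<Longrightarrow> \<tau> x \<in> L"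
      "\<And>x u. x \<in> C \<Longrightarrow> u \<in> L \<Longrightarrow> \<tau> x \<preceq> u \<Longrightarrow> P u x = lim_proj L x"
    by metis
  have "countable (\<tau> ` C)" "\<tau> ` C \<subseteq> L" using C(1) \<tau>(1) by auto
  then obtain t where t: "t \<in> L" "\<And>a. a \<in> \<tau> ` C \<Longrightarrow> a \<preceq> t"
    using countable_bound[OF L] by metis
  show ?thesis
  proof (rule that[OF t(1)])
    fix u x assume u: "u \<in> L" "t \<preceq> u" and x: "x \<in> C"
    have "\<tau> x \<preceq> u" using le_trans[OF t(2) u(2)] x by blast
    then show "P u x = lim_proj L x" by (rule \<tau>(2)[OF x u(1)])
  qed
qed

context
  fixes L assumes L: "directed L" "sup_closed L"
begin

lemma mem_Gamma: "s \<in> L \<Longrightarrow> s \<in> \<Gamma>"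
  using L(1) by (auto simp: directed_def)

lemma lim_proj_eq_P:
  assumes "L \<noteq> {}" "countable C" "C \<subseteq> X"
  obtains t where "t \<in> L" "t \<in> \<Gamma>" "\<And>x. x \<in> C \<Longrightarrow> P t x = lim_proj L x"
  using lim_proj_attained[OF L assms] mem_Gamma le_refl by metis

lemma lim_proj_X:
  assumes "x \<in> X"
  shows "lim_proj L x \<in> X"
proof (cases "L = {}")
  case False
  then obtain t where "t \<in> \<Gamma>" "P t x = lim_proj L x"
    using lim_proj_eq_P[of "{x}"] assms by auto
  then show ?thesis using P_X assms by metis
qed (simp add: lim_proj_empty zero_X)

lemma lim_proj_norm:
  assumes "x \<in> X"
  shows "norm (lim_proj L x) \<le> norm x"
proof (cases "L = {}")
  case False
  then obtain t where "t \<in> \<Gamma>" "P t x = lim_proj L x"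
    using lim_proj_eq_P[of "{x}"] assms by auto
  then show ?thesis using P_norm assms by metis
qed (simp add: lim_proj_empty)

lemma lim_proj_add:
  assumes "x \<in> X" "y \<in> X"
  shows "lim_proj L (x + y) = lim_proj L x + lim_proj L y"
proof (cases "L = {}")
  case False
  have "countable {x, y, x + y}" "{x, y, x + y} \<subseteq> X" using add_X assms by auto
  then obtain t where t: "t \<in> \<Gamma>" "\<And>z. z \<in> {x, y, x + y} \<Longrightarrow> P t z = lim_proj L z"
    using lim_proj_eq_P[OF False] by metis
  then show ?thesis using P_add[OF t(1) assms] by simp
qed (simp add: lim_proj_empty)

lemma lim_proj_smul:
  assumes "x \<in> X"
  shows "lim_proj L (smul c x) = smul c (lim_proj L x)"
proof (cases "L = {}")
  case False
  have "countable {x, smul c x}" "{x, smul c x} \<subseteq> X" using smul_X assms by auto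
  then obtain t where t: "t \<in> \<Gamma>" "\<And>z. z \<in> {x, smul c x} \<Longrightarrow> P t z = lim_proj L z"
    using lim_proj_eq_P[OF False] by metis
  then show ?thesis using P_smul[OF t(1) assms, of c] by simp
qed (simp add: lim_proj_empty)

lemma lim_proj_diff:
  assumes "x \<in> X" "y \<in> X"
  shows "lim_proj L (x - y) = lim_proj L x - lim_proj L y"
  using lim_proj_add[OF diff_X[OF assms] assms(2)] by (simp add: algebra_simps)

lemma lim_proj_fixed:
  assumes s: "s \<in> L" and x: "x \<in> X" "P s x = x"
  shows "lim_proj L x = x"
  using lim_proj_eqI[OF L(1) s] fixed_mono x by blast

lemma lim_proj_in_range:
  assumes "L \<noteq> {}" "x \<in> X"
  obtains s where "s \<in> L" "P s x = lim_proj L x" "P s (lim_proj L x) = lim_proj L x"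
proof -
  obtain t where t: "t \<in> L" "t \<in> \<Gamma>" "P t x = lim_proj L x"
    using lim_proj_eq_P[of "{x}"] assms by auto
  then show ?thesis using that P_idem assms(2) by metis
qed

lemma lim_proj_idem:
  assumes "x \<in> X"
  shows "lim_proj L (lim_proj L x) = lim_proj L x"
proof (cases "L = {}")
  case False
  then show ?thesis
    using lim_proj_in_range[OF False assms] lim_proj_fixed lim_proj_X[OF assms] by metis
qed (simp add: lim_proj_empty)

lemma P_lim_proj:
  assumes s: "s \<in> L" and x: "x \<in> X"
  shows "P s (lim_proj L x) = P s x"
proof -
  have "L \<noteq> {}" using s by auto
  then obtain t where t: "t \<in> L" "\<And>u x'. u \<in> L \<Longrightarrow> t \<preceq> u \<Longrightarrow> x' \<in> {x} \<Longrightarrow> P u x' = lim_proj L x'"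
    using lim_proj_attained[OF L, of "{x}"] x by auto
  obtain u where u: "u \<in> L" "s \<preceq> u" "t \<preceq> u" using directedD[OF L(1) s t(1)] by blast
  then have "lim_proj L x = P u x" using t(2) by simp
  then show ?thesis using P_le1[OF u(2) x] by simp
qed

lemma lim_proj_range: "lim_proj L ` X = {x\<in>X. lim_proj L x = x}"
  by (auto simp: lim_proj_X lim_proj_idem) (metis imageI)

lemma bounded_projection_lim_proj: "bounded_projection smul X (lim_proj L)"
  unfolding bounded_projection_def
  by (auto simp: lim_proj_X lim_proj_add lim_proj_smul lim_proj_idem intro!: exI[of _ 1] lim_proj_norm)

lemma opnorm_lim_proj:
  assumes "x \<in> X" "lim_proj L x \<noteq> 0"
  shows "opnorm_on X (lim_proj L) = 1"
  by (rule opnorm_projection_eq_1) (use assms lim_proj_X lim_proj_idem lim_proj_norm in auto)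

lemma continuous_on_lim_proj: "continuous_on X (lim_proj L)"
proof (rule continuous_on_iff[THEN iffD2], intro ballI allI impI)
  fix x and e :: real assume "x \<in> X" "e > 0"
  then show "\<exists>d>0. \<forall>x'\<in>X. dist x' x < d \<longrightarrow> dist (lim_proj L x') (lim_proj L x) < e"
    using lim_proj_norm[OF diff_X] lim_proj_diff
    by (intro exI[of _ e]) (auto simp: dist_norm intro: order.strict_trans1)
qed

lemma closed_lim_proj_range: "closed (lim_proj L ` X)"
proof -
  have "closedin (top_of_set X) {x\<in>X. lim_proj L x - x = 0}"
    by (intro continuous_closedin_preimage_constant continuous_intros continuous_on_lim_proj)
  then show ?thesis
    using closed_X by (simp add: lim_proj_range closedin_closed_eq)
qed

end

lemma continuous_on_P:
  assumes "s \<in> \<Gamma>"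
  shows "continuous_on X (P s)"
proof (rule continuous_on_iff[THEN iffD2], intro ballI allI impI)
  fix x and e :: real assume "x \<in> X" "e > 0"
  then show "\<exists>d>0. \<forall>x'\<in>X. dist x' x < d \<longrightarrow> dist (P s x') (P s x) < e"
    using P_norm[OF assms diff_X] P_diff[OF assms]
    by (intro exI[of _ e]) (auto simp: dist_norm intro: order.strict_trans1)
qed

context
  fixes L M assumes L: "directed L" "sup_closed L" and M: "directed M" "sup_closed M" and LM: "L \<subseteq> M"
begin

lemma lim_proj_below:
  assumes x: "x \<in> X"
  shows "lim_proj L (lim_proj M x) = lim_proj L x"
proof (cases "L = {}")
  case False
  have "countable {x, lim_proj M x}" "{x, lim_proj M x} \<subseteq> X" using lim_proj_X[OF M] x by auto
  then obtain t where t: "t \<in> L" "\<And>z. z \<in> {x, lim_proj M x} \<Longrightarrow> P t z = lim_proj L z"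
    using lim_proj_eq_P[OF L False] by metis
  then show ?thesis using P_lim_proj[OF M _ x, of t] LM by auto
qed (simp add: lim_proj_empty)

lemma lim_proj_above:
  assumes x: "x \<in> X"
  shows "lim_proj M (lim_proj L x) = lim_proj L x"
proof (cases "L = {}")
  case True
  then show ?thesis using lim_proj_norm[OF M zero_X] by (simp add: lim_proj_empty)
next
  case False
  show ?thesis
    using lim_proj_in_range[OF L False x] lim_proj_fixed[OF M] lim_proj_X[OF L x] LM by (metis subsetD)
qed

lemma lim_proj_range_mono: "lim_proj L ` X \<subseteq> lim_proj M ` X"
  using lim_proj_above lim_proj_X[OF L] by (auto simp: lim_proj_range[OF M])

end

lemma eq_on_closure:
  fixes f g :: "'a \<Rightarrow> 'a"
  assumes "continuous_on X f" "continuous_on X g" and "A \<subseteq> X"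
    and "\<And>x. x \<in> A \<Longrightarrow> f x = g x" and "z \<in> closure A"
  shows "f z = g z"
proof -
  have "closure A \<subseteq> X" using assms(3) closed_X by (rule closure_minimal)
  then have "continuous_on (closure A) (\<lambda>x. f x - g x)"
    using assms(1,2) by (intro continuous_intros) (auto intro: continuous_on_subset)
  then have "f z - g z = 0"
    by (rule continuous_constant_on_closure) (use assms(4,5) in auto)
  then show ?thesis by simp
qed

section \<open>Skeletons on the differences of two such projections\<close>

text \<open>
  An index adapted to a countable dense subset of the separable space \<open>P\<^sub>w X\<close> is adapted to all
  of it, by continuity.
\<close>

lemma lim_proj_attained_on_range:
  assumes L: "directed L" "sup_closed L" and t: "t \<in> L" and w: "w \<in> \<Gamma>"
  obtains t' where "t' \<in> L" "t \<preceq> t'" "\<And>x. x \<in> P w ` X \<Longrightarrow> P t' x = lim_proj L x"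
proof -
  obtain C where C: "countable C" "C \<subseteq> P w ` X" "P w ` X \<subseteq> closure C"
    using P_separable[OF w] by (auto simp: separable_iff_countable_dense dense_in_def)
  then have CX: "C \<subseteq> X" using P_X[OF w] by auto
  have ne: "L \<noteq> {}" using t by auto
  obtain r where r: "r \<in> L" "\<And>u x. u \<in> L \<Longrightarrow> r \<preceq> u \<Longrightarrow> x \<in> C \<Longrightarrow> P u x = lim_proj L x"
    using lim_proj_attained[OF L ne C(1) CX] by metis
  obtain t' where t': "t' \<in> L" "t \<preceq> t'" "r \<preceq> t'" using directedD[OF L(1) t r(1)] by blast
  show ?thesis
  proof (rule that[OF t'(1,2)])
    fix x assume "x \<in> P w ` X"
    then have "x \<in> closure C" using C(3) by blast
    with continuous_on_P[OF mem_Gamma[OF L t'(1)]] continuous_on_lim_proj[OF L] CX r(2)[OF t'(1,3)]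
    show "P t' x = lim_proj L x" by (rule eq_on_closure)
  qed
qed

context
  fixes L M assumes L: "directed L" "sup_closed L" and M: "directed M" "sup_closed M" and LM: "L \<subseteq> M"
begin

text \<open>
  Alternately enlarge \<open>t \<in> L\<close>, so that \<open>P\<^sub>t\<close> agrees with \<open>P\<^sub>L\<close> on the current
  range \<open>P\<^sub>w X\<close>, and \<open>w \<in> M\<close>, so that it lies above \<open>t\<close>. For the suprema, \<open>P\<^sub>L P\<^sub>w = P\<^sub>t P\<^sub>w = P\<^sub>t\<close>,
  and \<open>P\<^sub>t = P\<^sub>t P\<^sub>L\<close> vanishes on the kernel of \<open>P\<^sub>L\<close>.
\<close>

lemma cofinal_commuting:
  assumes u0: "u0 \<in> M"
  obtains w where "w \<in> M" "u0 \<preceq> w" "\<And>y. y \<in> X \<Longrightarrow> lim_proj L y = 0 \<Longrightarrow> lim_proj L (P w y) = 0"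
proof (cases "L = {}")
  case True
  then show ?thesis using that[OF u0 le_refl] mem_Gamma[OF M u0] by (simp add: lim_proj_empty)
next
  case False
  define good where "good p \<longleftrightarrow> fst p \<in> M \<and> snd p \<in> L \<and> u0 \<preceq> fst p \<and> snd p \<preceq> fst p" for p
  define step where "step p q \<longleftrightarrow> fst p \<preceq> fst q \<and> snd p \<preceq> snd q \<and>
      (\<forall>x\<in>P (fst p) ` X. P (snd q) x = lim_proj L x)" for p q
  have "\<exists>f. \<forall>n::nat. good (f n) \<and> step (f n) (f (Suc n))"
  proof (rule dependent_nat_choice)
    obtain t where t: "t \<in> L" using False by blast
    then obtain w where "w \<in> M" "u0 \<preceq> w" "t \<preceq> w" using directedD[OF M(1) u0, of t] LM by blast
    then have "good (w, t)" using t by (simp add: good_def)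
    then show "\<exists>p. good p" by blast
  next
    fix p :: "'i \<times> 'i" and n :: nat
    assume "good p"
    then have p: "fst p \<in> M" "snd p \<in> L" "u0 \<preceq> fst p" by (simp_all add: good_def)
    obtain t where t: "t \<in> L" "snd p \<preceq> t" "\<And>x. x \<in> P (fst p) ` X \<Longrightarrow> P t x = lim_proj L x"
      using lim_proj_attained_on_range[OF L p(2) mem_Gamma[OF M p(1)]] by metis
    obtain w where w: "w \<in> M" "fst p \<preceq> w" "t \<preceq> w" using directedD[OF M(1) p(1), of t] t(1) LM by blast
    have "good (w, t)" using t w le_trans[OF p(3) w(2)] by (simp add: good_def)
    moreover have "step p (w, t)" using t w unfolding step_def fst_conv snd_conv by blast
    ultimately show "\<exists>q. good q \<and> step p q" by blast
  qed
  then obtain f :: "nat \<Rightarrow> 'i \<times> 'i" where f: "\<And>n. good (f n)" "\<And>n. step (f n) (f (Suc n))" by blast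
  define \<omega> \<tau> where "\<omega> n = fst (f n)" and "\<tau> n = snd (f n)" for n
  have \<omega>: "\<omega> n \<in> M" "u0 \<preceq> \<omega> n" "\<omega> n \<preceq> \<omega> (Suc n)" and \<tau>: "\<tau> n \<in> L" "\<tau> n \<preceq> \<omega> n" "\<tau> n \<preceq> \<tau> (Suc n)"
    and eq: "x \<in> P (\<omega> n) ` X \<Longrightarrow> P (\<tau> (Suc n)) x = lim_proj L x" for n x
    using f[of n] unfolding good_def step_def \<omega>_def \<tau>_def by blast+
  obtain w where w: "is_sup_seq \<Gamma> le \<omega> w" using sup_exists \<omega>(3) by blast
  obtain t where t: "is_sup_seq \<Gamma> le \<tau> t" using sup_exists \<tau>(3) by blast
  have wM: "w \<in> M" by (rule sup_closedD[OF M(2) \<omega>(1,3) w])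
  have tL: "t \<in> L" by (rule sup_closedD[OF L(2) \<tau>(1,3) t])
  have wG: "w \<in> \<Gamma>" and tG: "t \<in> \<Gamma>" using w t by (auto simp: is_sup_seq_def)
  have tw: "t \<preceq> w" using t wG le_sup[OF \<tau>(2) w] by (auto simp: is_sup_seq_def)
  have agree: "lim_proj L x = P t x" if x: "x \<in> P w ` X" for x
  proof (rule eq_on_closure[OF continuous_on_lim_proj[OF L] continuous_on_P[OF tG]])
    show "x \<in> closure (\<Union>n. P (\<omega> n) ` X)" using x sup_range[OF \<omega>(3) w] by simp
    show "(\<Union>n. P (\<omega> n) ` X) \<subseteq> X" using P_X mem_Gamma[OF M \<omega>(1)] by blast
    fix z assume "z \<in> (\<Union>n. P (\<omega> n) ` X)"
    then obtain n where n: "z \<in> P (\<omega> n) ` X" by blast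
    then have zX: "z \<in> X" using P_X mem_Gamma[OF M \<omega>(1)] by blast
    have "\<tau> (Suc n) \<preceq> t" using t by (simp add: is_sup_seq_def)
    then have "P t (lim_proj L z) = lim_proj L z"
      unfolding eq[OF n, symmetric] by (rule P_le2[OF _ zX])
    then show "lim_proj L z = P t z" using P_lim_proj[OF L tL zX] by simp
  qed
  show ?thesis
  proof (rule that[OF wM])
    show "u0 \<preceq> w" using le_sup[OF \<omega>(2) w] .
    fix y assume y: "y \<in> X" "lim_proj L y = 0"
    have "lim_proj L (P w y) = P t (P w y)" using agree y(1) by blast
    also have "\<dots> = P t y" using P_le1[OF tw y(1)] .
    also have "\<dots> = P t (lim_proj L y)" using P_lim_proj[OF L tL y(1)] by simp
    also have "\<dots> = 0" using P_norm[OF tG zero_X] y(2) by simp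
    finally show "lim_proj L (P w y) = 0" .
  qed
qed

lemma difference_range:
  "(\<lambda>x. lim_proj M x - lim_proj L x) ` X = {y\<in>X. lim_proj M y = y \<and> lim_proj L y = 0}" (is "?D = ?Y")
proof
  show "?D \<subseteq> ?Y"
    using lim_proj_X[OF L] lim_proj_X[OF M] lim_proj_above[OF L M LM] lim_proj_below[OF L M LM]
    by (auto simp: diff_X lim_proj_diff[OF L] lim_proj_diff[OF M] lim_proj_idem[OF L] lim_proj_idem[OF M])
  show "?Y \<subseteq> ?D" by (force intro: rev_image_eqI)
qed

text \<open>
  The vector \<open>x0\<close> guarantees that the difference is not \<open>{0}\<close>. The index set consists of
  the \<open>u \<in> M\<close> for which \<open>P\<^sub>u\<close> restricts to a non-zero operator on the difference. Both conditions
  survive suprema of increasing sequences, and the first one holds cofinally in \<open>M\<close>. The second one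
  passes to larger indices.
\<close>

theorem difference_admits_one_skeleton:
  assumes x0: "x0 \<in> X" "lim_proj M x0 \<noteq> lim_proj L x0"
  shows "admits_one_skeleton TYPE('i) smul ((\<lambda>x. lim_proj M x - lim_proj L x) ` X)"
proof -
  define Y where "Y = (\<lambda>x. lim_proj M x - lim_proj L x) ` X"
  have Y: "Y = {y\<in>X. lim_proj M y = y \<and> lim_proj L y = 0}"
    unfolding Y_def by (rule difference_range)
  then have YX: "y \<in> Y \<Longrightarrow> y \<in> X" for y by simp
  define \<Delta> where "\<Delta> = {u\<in>M. P u ` Y \<subseteq> Y \<and> (\<exists>y\<in>Y. P u y \<noteq> 0)}"
  define le' where "le' = Restr le \<Delta>"
  have \<Delta>M: "u \<in> \<Delta> \<Longrightarrow> u \<in> M" and \<Delta>G: "u \<in> \<Delta> \<Longrightarrow> u \<in> \<Gamma>" and \<Delta>Y: "u \<in> \<Delta> \<Longrightarrow> y \<in> Y \<Longrightarrow> P u y \<in> Y" for u y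
    using mem_Gamma[OF M] by (auto simp: \<Delta>_def)
  have in_\<Delta>: "w \<in> \<Delta>" if "w \<in> M" "P w y = y" "P w ` Y \<subseteq> Y" "y \<in> Y" "y \<noteq> 0" for w y
    using that unfolding \<Delta>_def by (auto intro!: bexI[of _ y])
  have M_ne: "M \<noteq> {}" using x0(2) LM by (auto simp: lim_proj_empty)
  have Y_sub: "S.subspace Y"
    unfolding Y
  proof (rule S.subspaceI)
    have "lim_proj M 0 = 0" "lim_proj L 0 = 0"
      using lim_proj_norm[OF M zero_X] lim_proj_norm[OF L zero_X] by simp_all
    then show "0 \<in> {y\<in>X. lim_proj M y = y \<and> lim_proj L y = 0}" using zero_X by simp
  qed (auto simp: add_X smul_X lim_proj_add[OF L] lim_proj_add[OF M] lim_proj_smul[OF L] lim_proj_smul[OF M])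
  have "closedin (top_of_set X) {y\<in>X. lim_proj L y = 0}"
    by (intro continuous_closedin_preimage_constant continuous_on_lim_proj L)
  then have "closed {y\<in>X. lim_proj L y = 0}" using closed_X by (simp add: closedin_closed_eq)
  moreover have "Y = lim_proj M ` X \<inter> {y\<in>X. lim_proj L y = 0}"
    using lim_proj_range[OF M] Y by auto
  ultimately have Y_closed: "closed Y"
    using closed_lim_proj_range[OF M] by auto
  have cofinal: "\<exists>w\<in>M. u \<preceq> w \<and> P w ` Y \<subseteq> Y" if u: "u \<in> M" for u
  proof -
    obtain w where w: "w \<in> M" "u \<preceq> w" "\<And>y. y \<in> X \<Longrightarrow> lim_proj L y = 0 \<Longrightarrow> lim_proj L (P w y) = 0"
      using cofinal_commuting[OF u] by metis
    have wG: "w \<in> \<Gamma>" using mem_Gamma[OF M w(1)] .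
    have "P w y \<in> Y" if "y \<in> Y" for y
    proof -
      have y: "y \<in> X" "lim_proj L y = 0" using that Y by auto
      then show ?thesis
        using P_X[OF wG y(1)] w(3)[OF y] lim_proj_fixed[OF M w(1) P_X[OF wG y(1)]] P_idem[OF wG y(1)]
        by (simp add: Y)
    qed
    then show ?thesis using w by blast
  qed
  have P_nonzero_mono: "P v y \<noteq> 0" if "u \<preceq> v" "y \<in> X" "P u y \<noteq> 0" for u v y
  proof
    assume "P v y = 0"
    then have "P u y = P u 0" using P_le1[OF that(1,2)] by simp
    then show False using that P_norm[OF _ zero_X, of u] le_Gamma[OF that(1)] by simp
  qed
  have covered: "\<exists>w\<in>M. P w y = y \<and> P w ` Y \<subseteq> Y" if y: "y \<in> Y" for y
  proof -
    have "lim_proj M y = y" using y Y by simp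
    then obtain s where s: "s \<in> M" "P s y = y"
      using lim_proj_in_range[OF M M_ne YX[OF y]] by metis
    obtain w where "w \<in> M" "s \<preceq> w" "P w ` Y \<subseteq> Y" using cofinal[OF s(1)] by blast
    then show ?thesis using fixed_mono[OF _ YX[OF y] s(2)] by blast
  qed
  have "lim_proj M x0 - lim_proj L x0 \<in> Y" using x0(1) by (simp add: Y_def)
  then obtain y0 where y0: "y0 \<in> Y" "y0 \<noteq> 0" using x0(2) by (metis right_minus_eq)
  have dir: "\<exists>w\<in>\<Delta>. u \<preceq> w \<and> v \<preceq> w" if uv: "u \<in> \<Delta>" "v \<in> \<Delta>" for u v
  proof -
    obtain r where r: "r \<in> M" "u \<preceq> r" "v \<preceq> r" using directedD[OF M(1)] \<Delta>M uv by blast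
    obtain w where w: "w \<in> M" "r \<preceq> w" "P w ` Y \<subseteq> Y" using cofinal[OF r(1)] by blast
    have uw: "u \<preceq> w" and vw: "v \<preceq> w" using le_trans[OF _ w(2)] r by blast+
    obtain y where "y \<in> Y" "P u y \<noteq> 0" using uv(1) by (auto simp: \<Delta>_def)
    then have "w \<in> \<Delta>" using w P_nonzero_mono[OF uw] YX by (auto simp: \<Delta>_def)
    then show ?thesis using uw vw by blast
  qed
  have "one_projectional_skeleton smul Y \<Delta> le' P"
    unfolding one_projectional_skeleton_def projectional_skeleton_def
  proof (intro conjI ballI allI impI)
    show "banach_space smul Y"
      using S.normed_space_over_axioms Y_sub Y_closed by (simp add: banach_space_def)
    show "partial_order_on \<Delta> le'"
      unfolding partial_order_on_def preorder_on_def
    proof (intro conjI)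
      show "le' \<subseteq> \<Delta> \<times> \<Delta>" by (auto simp: le'_def)
      show "refl_on \<Delta> le'" using le_refl \<Delta>G by (auto simp: le'_def refl_on_def)
      show "trans le'" using le_trans unfolding le'_def trans_def by blast
      show "antisym le'" using le_antisym unfolding le'_def antisym_def by blast
    qed
    obtain w where "w \<in> M" "P w y0 = y0" "P w ` Y \<subseteq> Y" using covered[OF y0(1)] by blast
    then have "w \<in> \<Delta>" using in_\<Delta> y0 by blast
    then show "up_directed \<Delta> le'"
      using dir by (fastforce simp: up_directed_def le'_def)
  next
    fix s assume s: "s \<in> \<Delta>"
    note sG = \<Delta>G[OF s]
    show "bounded_projection smul Y (P s)"
      unfolding bounded_projection_def
      using P_add[OF sG] P_smul[OF sG] P_idem[OF sG] P_norm[OF sG] \<Delta>Y[OF s] YX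
      by (auto intro!: exI[of _ 1])
    show "separable (P s ` Y)"
      by (rule separable_subset[OF P_separable[OF sG]]) (use YX in auto)
    obtain y where "y \<in> Y" "P s y \<noteq> 0" using s by (auto simp: \<Delta>_def)
    then show "opnorm_on Y (P s) = 1"
      using P_idem[OF sG] P_norm[OF sG] \<Delta>Y[OF s] YX by (intro opnorm_projection_eq_1) auto
  next
    fix s t x assume "(s, t) \<in> le'" "x \<in> Y"
    then show "P s (P t x) = P s x" "P t (P s x) = P s x"
      using P_le1 P_le2 YX by (auto simp: le'_def)
  next
    fix \<sigma> assume \<sigma>: "\<forall>n. \<sigma> n \<in> \<Delta> \<and> (\<sigma> n, \<sigma> (Suc n)) \<in> le'"
    then have inc: "\<sigma> n \<preceq> \<sigma> (Suc n)" and mem: "\<sigma> n \<in> \<Delta>" for n by (auto simp: le'_def)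
    obtain s where s: "is_sup_seq \<Gamma> le \<sigma> s" using sup_exists inc by blast
    have sM: "s \<in> M" using sup_closedD[OF M(2) \<Delta>M[OF mem] inc s] .
    have sG: "s \<in> \<Gamma>" and le: "\<sigma> n \<preceq> s" for n using s by (auto simp: is_sup_seq_def)
    have sY: "P s y \<in> Y" if "y \<in> Y" for y
      using \<Delta>Y[OF mem that] by (intro sup_fixed[of \<sigma>, OF inc s YX[OF that] Y_closed]) auto
    obtain y where "y \<in> Y" "P (\<sigma> 0) y \<noteq> 0" using mem[of 0] by (auto simp: \<Delta>_def)
    then have s_in: "s \<in> \<Delta>" using P_nonzero_mono[OF le] YX sY sM by (auto simp: \<Delta>_def)
    have "is_sup_seq \<Delta> le' \<sigma> s"
      using s s_in mem \<Delta>G by (simp add: is_sup_seq_def le'_def)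
    moreover have "P s ` Y = closure (\<Union>n. P (\<sigma> n) ` Y)"
    proof
      \<comment> \<open>The closure formula for the ranges in \<open>X\<close> does not restrict to \<open>Y\<close>, but the convergence of
        \<open>P (\<sigma> n) y\<close> to \<open>P s y\<close> takes place inside \<open>Y\<close>.\<close>
      show "P s ` Y \<subseteq> closure (\<Union>n. P (\<sigma> n) ` Y)"
      proof
        fix z assume "z \<in> P s ` Y"
        then obtain y where y: "y \<in> Y" "z = P s y" by blast
        have "P (\<sigma> n) y \<in> (\<Union>n. P (\<sigma> n) ` Y)" for n
          using y(1) by blast
        then have "P (\<sigma> n) y \<in> closure (\<Union>n. P (\<sigma> n) ` Y)" for n
          by (rule subsetD[OF closure_subset])
        then show "z \<in> closure (\<Union>n. P (\<sigma> n) ` Y)"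
          unfolding y(2) by (intro sup_fixed[of \<sigma>, OF inc s YX[OF y(1)] closed_closure]) auto
      qed
      have "P s ` Y = P s ` X \<inter> Y"
        using sY YX P_idem[OF sG] by (auto simp: P_range[OF sG]) (metis imageI)
      moreover have "closed (P s ` X)" using sup_range[OF inc s] by simp
      ultimately have "closed (P s ` Y)" using Y_closed by auto
      moreover have "P (\<sigma> n) y \<in> P s ` Y" if "y \<in> Y" for n y
        using P_le2[OF le YX[OF that]] \<Delta>Y[OF mem that] by (metis imageI)
      ultimately show "closure (\<Union>n. P (\<sigma> n) ` Y) \<subseteq> P s ` Y"
        by (intro closure_minimal) auto
    qed
    ultimately show "\<exists>s. is_sup_seq \<Delta> le' \<sigma> s \<and> P s ` Y = closure (\<Union>n. P (\<sigma> n) ` Y)" by blast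
  next
    have "y \<in> (\<Union>s\<in>\<Delta>. P s ` Y)" if y: "y \<in> Y" for y
    proof (cases "y = 0")
      case True
      obtain w where w: "w \<in> M" "P w y0 = y0" "P w ` Y \<subseteq> Y" using covered[OF y0(1)] by blast
      then have "w \<in> \<Delta>" using in_\<Delta> y0 by blast
      moreover have "P w y = y" using True P_norm[OF mem_Gamma[OF M w(1)] zero_X] by simp
      ultimately show ?thesis using y by (metis UN_I imageI)
    next
      case False
      obtain w where w: "w \<in> M" "P w y = y" "P w ` Y \<subseteq> Y" using covered[OF y] by blast
      then have "w \<in> \<Delta>" using in_\<Delta> y False by blast
      then show ?thesis using y w(2) by (metis UN_I imageI)
    qed
    then show "Y = (\<Union>s\<in>\<Delta>. P s ` Y)" using \<Delta>Y by auto
  qed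
  then show ?thesis unfolding admits_one_skeleton_def Y_def by blast
qed

end

section \<open>Sigma-directed sets generated by subsets of the space\<close>

lemma lim_proj_hull_dense:
  assumes T: "directed T" "T \<noteq> {}"
  shows "lim_proj (sup_hull T) ` X \<subseteq> closure (\<Union>s\<in>T. P s ` X)"
proof -
  let ?C = "closure (\<Union>s\<in>T. P s ` X)"
  let ?L = "{s. P s ` X \<subseteq> ?C}"
  have "sup_closed ?L"
    unfolding sup_closed_def
  proof (intro allI impI)
    fix \<sigma> s assume \<sigma>: "\<forall>n. \<sigma> n \<in> ?L \<and> \<sigma> n \<preceq> \<sigma> (Suc n)" and s: "is_sup_seq \<Gamma> le \<sigma> s"
    have "P s ` X = closure (\<Union>n. P (\<sigma> n) ` X)" using sup_range[of \<sigma> s] \<sigma> s by blast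
    also have "\<dots> \<subseteq> ?C" using \<sigma> by (intro closure_minimal closed_closure) auto
    finally show "s \<in> ?L" by simp
  qed
  moreover have "T \<subseteq> ?L"
  proof
    fix s assume "s \<in> T"
    then have "P s ` X \<subseteq> (\<Union>s\<in>T. P s ` X)" by blast
    then show "s \<in> ?L" using closure_subset by blast
  qed
  ultimately have hull: "sup_hull T \<subseteq> ?L" by (intro sup_hull_least)
  have ne: "sup_hull T \<noteq> {}" using T(2) sup_hull.base by blast
  show ?thesis
  proof
    fix y assume "y \<in> lim_proj (sup_hull T) ` X"
    then obtain x where x: "x \<in> X" "y = lim_proj (sup_hull T) x" by blast
    then obtain s where "s \<in> sup_hull T" "P s x = y"
      using lim_proj_in_range[OF directed_sup_hull[OF T(1)] sup_closed_hull ne x(1)] by metis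
    then show "y \<in> ?C" using hull x(1) by blast
  qed
qed

lemma P_nonzero:
  assumes "s \<in> \<Gamma>"
  obtains x where "x \<in> X" "P s x \<noteq> 0"
proof -
  have "\<exists>x\<in>X. P s x \<noteq> 0"
  proof (rule ccontr)
    assume "\<not> ?thesis"
    then have "(\<lambda>x. norm (P s x) / norm x) ` X = {0}" using zero_X by (auto intro!: image_eqI[of _ _ 0])
    then show False using P_opnorm[OF assms] by (simp add: opnorm_on_def)
  qed
  then show ?thesis using that by blast
qed

text \<open>
  By recursion along strict inclusion: a finite set has finitely many subsets, so there is
  an index above those already chosen for its proper subsets. Monotonicity makes the images of
  families of finite sets directed.
\<close>

lemma finite_bounds_exist:
  "\<exists>g. \<forall>F. finite F \<and> F \<subseteq> X \<longrightarrow>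
     g F \<in> \<Gamma> \<and> (\<forall>x\<in>F. P (g F) x = x) \<and> (\<forall>F'. F' \<subset> F \<longrightarrow> g F' \<preceq> g F)"
proof (rule dependent_wf_choice[OF wf_finite_psubset])
  fix g h :: "'a set \<Rightarrow> 'i" and F s
  assume eq: "\<And>F'. (F', F) \<in> finite_psubset \<Longrightarrow> g F' = h F'"
  have "(\<forall>F'. F' \<subset> F \<longrightarrow> g F' \<preceq> s) \<longleftrightarrow> (\<forall>F'. F' \<subset> F \<longrightarrow> h F' \<preceq> s)" if "finite F"
    using eq that by (simp add: finite_psubset_def)
  then show "(finite F \<and> F \<subseteq> X \<longrightarrow> s \<in> \<Gamma> \<and> (\<forall>x\<in>F. P s x = x) \<and> (\<forall>F'. F' \<subset> F \<longrightarrow> g F' \<preceq> s)) =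
    (finite F \<and> F \<subseteq> X \<longrightarrow> s \<in> \<Gamma> \<and> (\<forall>x\<in>F. P s x = x) \<and> (\<forall>F'. F' \<subset> F \<longrightarrow> h F' \<preceq> s))"
    by (cases "finite F") simp_all
next
  fix F and g :: "'a set \<Rightarrow> 'i"
  assume IH: "\<And>F'. (F', F) \<in> finite_psubset \<Longrightarrow> finite F' \<and> F' \<subseteq> X \<longrightarrow>
    g F' \<in> \<Gamma> \<and> (\<forall>x\<in>F'. P (g F') x = x) \<and> (\<forall>F''. F'' \<subset> F' \<longrightarrow> g F'' \<preceq> g F')"
  show "\<exists>s. finite F \<and> F \<subseteq> X \<longrightarrow> s \<in> \<Gamma> \<and> (\<forall>x\<in>F. P s x = x) \<and> (\<forall>F'. F' \<subset> F \<longrightarrow> g F' \<preceq> s)"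
  proof (cases "finite F \<and> F \<subseteq> X")
    case True
    have "\<exists>s\<in>\<Gamma>. P s x = x" if "x \<in> X" for x
    proof -
      have "x \<in> (\<Union>s\<in>\<Gamma>. P s ` X)" using that by (subst X_eq[symmetric])
      then obtain s z where "s \<in> \<Gamma>" "z \<in> X" "x = P s z" by blast
      then show ?thesis using P_idem by auto
    qed
    then obtain r where r: "\<And>x. x \<in> X \<Longrightarrow> r x \<in> \<Gamma>" "\<And>x. x \<in> X \<Longrightarrow> P (r x) x = x" by metis
    have g: "g F' \<in> \<Gamma>" if "F' \<subset> F" for F'
      using IH[of F'] that True finite_subset[of F' F] by (auto simp: finite_psubset_def)
    have "finite {F'. F' \<subset> F}" using True by (auto intro: finite_subset[of _ "Pow F"])
    then have "countable (r ` F \<union> g ` {F'. F' \<subset> F})" using True by (simp add: countable_finite)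
    moreover have "r ` F \<union> g ` {F'. F' \<subset> F} \<subseteq> \<Gamma>" using r(1) g True by auto
    ultimately obtain u where u: "u \<in> \<Gamma>" "\<And>s. s \<in> r ` F \<union> g ` {F'. F' \<subset> F} \<Longrightarrow> s \<preceq> u"
      using countable_bound[OF sigma_directed_Gamma Gamma_ne] by metis
    have "P u x = x" if "x \<in> F" for x
      using fixed_mono[of "r x" u x] u(2)[of "r x"] r(2)[of x] True that by auto
    then show ?thesis using u by blast
  qed blast
qed

definition finite_bound :: "'a set \<Rightarrow> 'i" where
  "finite_bound = (SOME g. \<forall>F. finite F \<and> F \<subseteq> X \<longrightarrow>
     g F \<in> \<Gamma> \<and> (\<forall>x\<in>F. P (g F) x = x) \<and> (\<forall>F'. F' \<subset> F \<longrightarrow> g F' \<preceq> g F))"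

lemma
  assumes "finite F" "F \<subseteq> X"
  shows finite_bound_in: "finite_bound F \<in> \<Gamma>"
    and finite_bound_fixes: "x \<in> F \<Longrightarrow> P (finite_bound F) x = x"
    and finite_bound_mono: "F' \<subseteq> F \<Longrightarrow> finite_bound F' \<preceq> finite_bound F"
proof -
  have *: "finite_bound F \<in> \<Gamma> \<and> (\<forall>x\<in>F. P (finite_bound F) x = x) \<and>
      (\<forall>F'. F' \<subset> F \<longrightarrow> finite_bound F' \<preceq> finite_bound F)"
    using someI_ex[OF finite_bounds_exist] assms unfolding finite_bound_def[symmetric] by blast
  then show "finite_bound F \<in> \<Gamma>" "x \<in> F \<Longrightarrow> P (finite_bound F) x = x" by blast+
  show "F' \<subseteq> F \<Longrightarrow> finite_bound F' \<preceq> finite_bound F"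
    using * le_refl by (cases "F' = F") auto
qed

text \<open>
  The empty set of vectors is left out so that the empty \<open>A\<close> generates the empty set of
  indices and hence the zero projection.
\<close>

definition finite_bounds :: "'a set \<Rightarrow> 'i set" where
  "finite_bounds A = finite_bound ` (Fpow A - {{}})"

definition proj_on :: "'a set \<Rightarrow> 'a \<Rightarrow> 'a" where
  "proj_on A = lim_proj (sup_hull (finite_bounds A))"

lemma finite_bounds_mono: "A \<subseteq> B \<Longrightarrow> finite_bounds A \<subseteq> finite_bounds B"
  unfolding finite_bounds_def using Fpow_mono by blast

lemma finite_bounds_eq_empty: "finite_bounds A = {} \<longleftrightarrow> A = {}"
proof -
  have "{a} \<in> Fpow A" if "a \<in> A" for a using that by (simp add: Fpow_def)
  then show ?thesis by (auto simp: finite_bounds_def Fpow_def)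
qed

lemma directed_finite_bounds:
  assumes "A \<subseteq> X"
  shows "directed (finite_bounds A)"
proof -
  have F: "finite F \<and> F \<subseteq> X" if "F \<in> Fpow A" for F using that assms by (auto simp: Fpow_def)
  have "\<exists>u\<in>finite_bounds A. s \<preceq> u \<and> t \<preceq> u" if st: "s \<in> finite_bounds A" "t \<in> finite_bounds A" for s t
  proof -
    obtain F G where FG: "F \<in> Fpow A" "F \<noteq> {}" "s = finite_bound F" "G \<in> Fpow A" "t = finite_bound G"
      using st by (auto simp: finite_bounds_def)
    have U: "F \<union> G \<in> Fpow A" using FG by (auto simp: Fpow_def)
    then have "finite_bound (F \<union> G) \<in> finite_bounds A" using FG(2) by (auto simp: finite_bounds_def)
    moreover have "s \<preceq> finite_bound (F \<union> G)" "t \<preceq> finite_bound (F \<union> G)"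
      using F[OF U] finite_bound_mono[of "F \<union> G"] FG by auto
    ultimately show ?thesis by blast
  qed
  moreover have "finite_bounds A \<subseteq> \<Gamma>"
    using F finite_bound_in by (auto simp: finite_bounds_def)
  ultimately show ?thesis by (simp add: directed_def)
qed

lemma sigma_directed_generated:
  assumes "A \<subseteq> X"
  shows "directed (sup_hull (finite_bounds A))" "sup_closed (sup_hull (finite_bounds A))"
  using directed_sup_hull[OF directed_finite_bounds[OF assms]] sup_closed_hull by auto

lemma proj_on_empty: "proj_on {} x = 0"
  using finite_bounds_eq_empty[of "{}"] by (simp add: proj_on_def sup_hull_empty lim_proj_empty)

lemma proj_on_fixes:
  assumes "A \<subseteq> X" "x \<in> A"
  shows "proj_on A x = x"
proof -
  have "finite_bound {x} \<in> finite_bounds A" using assms by (auto simp: finite_bounds_def Fpow_def)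
  then have "finite_bound {x} \<in> sup_hull (finite_bounds A)" by (rule sup_hull.base)
  then show ?thesis
    unfolding proj_on_def
    by (rule lim_proj_fixed[OF sigma_directed_generated[OF assms(1)]]) (use assms finite_bound_fixes[of "{x}"] in auto)
qed

lemma opnorm_proj_on:
  assumes "A \<subseteq> X" "A \<noteq> {}"
  shows "opnorm_on X (proj_on A) = 1"
proof -
  obtain s where s: "s \<in> finite_bounds A" using finite_bounds_eq_empty assms(2) by blast
  then have sh: "s \<in> sup_hull (finite_bounds A)" by (rule sup_hull.base)
  have sG: "s \<in> \<Gamma>" using s directed_finite_bounds[OF assms(1)] by (auto simp: directed_def)
  then obtain x where x: "x \<in> X" "P s x \<noteq> 0" using P_nonzero by blast
  have "proj_on A (P s x) = P s x"
    unfolding proj_on_def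
    using lim_proj_fixed[OF sigma_directed_generated[OF assms(1)] sh P_X[OF sG x(1)] P_idem[OF sG x(1)]] .
  then show ?thesis
    unfolding proj_on_def
    using opnorm_lim_proj[OF sigma_directed_generated[OF assms(1)] P_X[OF sG x(1)]] x(2) by simp
qed

text \<open>
  The ranges indexed by the generating directed set are separable and their union is dense,
  so it suffices to collect a countable dense set from each of them.
\<close>

lemma proj_on_dense_subset:
  assumes A: "A \<subseteq> X"
  obtains E where "dense_in (proj_on A ` X) E" "countable E \<or> (infinite A \<and> |E| \<le>o |A| )"
proof (cases "A = {}")
  case True
  then have "proj_on A ` X = {0}" using zero_X by (auto simp: proj_on_empty)
  then show ?thesis using that[of "{0}"] by (simp add: dense_in_def)
next
  case False
  define T where "T = finite_bounds A"
  have T: "directed T" "T \<noteq> {}" "T \<subseteq> \<Gamma>"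
    using directed_finite_bounds[OF A] finite_bounds_eq_empty[of A] False by (auto simp: T_def directed_def)
  have "\<forall>s\<in>T. \<exists>C. countable C \<and> C \<subseteq> P s ` X \<and> P s ` X \<subseteq> closure C"
    using P_separable T(3) by (auto simp: separable_iff_countable_dense dense_in_def)
  then obtain C where C: "\<And>s. s \<in> T \<Longrightarrow> countable (C s)" "\<And>s. s \<in> T \<Longrightarrow> C s \<subseteq> P s ` X"
     "\<And>s. s \<in> T \<Longrightarrow> P s ` X \<subseteq> closure (C s)" by metis
  define E where "E = (\<Union>s\<in>T. C s)"
  have "(\<Union>s\<in>T. P s ` X) \<subseteq> closure E"
  proof (rule UN_least)
    fix s assume s: "s \<in> T"
    then have "C s \<subseteq> E" by (auto simp: E_def)
    then show "P s ` X \<subseteq> closure E" using C(3)[OF s] closure_mono by blast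
  qed
  then have "closure (\<Union>s\<in>T. P s ` X) \<subseteq> closure E" by (intro closure_minimal) auto
  then have "proj_on A ` X \<subseteq> closure E"
    using lim_proj_hull_dense[OF T(1,2)] by (auto simp: proj_on_def T_def)
  moreover have "E \<subseteq> proj_on A ` X"
  proof
    fix z assume "z \<in> E"
    then obtain s where s: "s \<in> T" "z \<in> P s ` X" using C(2) unfolding E_def by blast
    have sG: "s \<in> \<Gamma>" using s(1) T(3) by blast
    have "z \<in> X" "P s z = z" using s(2) P_range[OF sG] by auto
    then show "z \<in> proj_on A ` X"
      using lim_proj_fixed[OF sigma_directed_generated[OF A] sup_hull.base] s(1)
      by (auto simp: proj_on_def T_def lim_proj_range[OF sigma_directed_generated[OF A]])
  qed
  ultimately have "dense_in (proj_on A ` X) E" by (simp add: dense_in_def)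
  moreover have "countable E \<or> (infinite A \<and> |E| \<le>o |A| )"
  proof (cases "finite A")
    case True
    then have "finite (Fpow A)" by (simp add: Fpow_Pow_finite)
    then have "finite T" by (simp add: T_def finite_bounds_def)
    then show ?thesis using C(1) by (auto simp: E_def countable_finite)
  next
    case False
    have "|T| \<le>o |Fpow A - {{}}|" unfolding T_def finite_bounds_def by (rule card_of_image)
    also have "|Fpow A - {{}}| \<le>o |Fpow A|" by (rule card_of_mono1) auto
    also have "|Fpow A| \<le>o |A|" by (rule ordIso_imp_ordLeq[OF card_of_Fpow_infinite[OF False]])
    finally have TA: "|T| \<le>o |A|" .
    have "|C s| \<le>o |A|" if "s \<in> T" for s
      using C(1)[OF that] False by (meson countable_card_le_natLeq infinite_iff_natLeq_ordLeq ordLeq_transitive)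
    then have "|E| \<le>o |A|"
      unfolding E_def using card_of_UNION_ordLeq_infinite[OF False TA] by blast
    then show ?thesis using False by blast
  qed
  ultimately show ?thesis by (rule that)
qed

context
  fixes A B assumes AB: "A \<subseteq> B" "B \<subseteq> X"
begin

lemma generated_subset: "sup_hull (finite_bounds A) \<subseteq> sup_hull (finite_bounds B)"
  by (intro sup_hull_mono finite_bounds_mono AB)

lemmas generated_sets =
  sigma_directed_generated[OF order.trans[OF AB]] sigma_directed_generated[OF AB(2)] generated_subset

lemmas proj_on_below = lim_proj_below[OF generated_sets, folded proj_on_def]
lemmas proj_on_above = lim_proj_above[OF generated_sets, folded proj_on_def]
lemmas proj_on_range_mono = lim_proj_range_mono[OF generated_sets, folded proj_on_def]
lemmas proj_on_difference = difference_admits_one_skeleton[OF generated_sets, folded proj_on_def]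

end

lemma closed_proj_on_range: "A \<subseteq> X \<Longrightarrow> closed (proj_on A ` X)"
  unfolding proj_on_def by (intro closed_lim_proj_range sigma_directed_generated)

lemma proj_on_range: "A \<subseteq> X \<Longrightarrow> proj_on A ` X = {x\<in>X. proj_on A x = x}"
  unfolding proj_on_def by (intro lim_proj_range sigma_directed_generated)

text \<open>
  A finite subset of the union of a chain already lies in a member of the chain, so the directed
  set generated by the union is the union of the generated directed sets.
\<close>

lemma proj_on_chain:
  assumes \<A>: "subset.chain UNIV \<A>" "\<A> \<noteq> {}" and U: "\<Union>\<A> = B" "B \<subseteq> X"
  shows "proj_on B ` X = closure (\<Union>A\<in>\<A>. proj_on A ` X)"
proof
  have AX: "A \<subseteq> X" if "A \<in> \<A>" for A using that U by blast
  show "closure (\<Union>A\<in>\<A>. proj_on A ` X) \<subseteq> proj_on B ` X"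
  proof (rule closure_minimal[OF UN_least closed_proj_on_range[OF U(2)]])
    fix A assume "A \<in> \<A>"
    then show "proj_on A ` X \<subseteq> proj_on B ` X" using U by (intro proj_on_range_mono) auto
  qed
  show "proj_on B ` X \<subseteq> closure (\<Union>A\<in>\<A>. proj_on A ` X)"
  proof (cases "B = {}")
    case True
    then have "A = {}" if "A \<in> \<A>" for A using that U(1) by blast
    then have "\<A> = {{}}" using \<A>(2) by blast
    then show ?thesis using True by (simp add: closure_subset)
  next
    case False
    have "(\<Union>s\<in>finite_bounds B. P s ` X) \<subseteq> (\<Union>A\<in>\<A>. proj_on A ` X)"
    proof (rule UN_least)
      fix s assume "s \<in> finite_bounds B"
      then obtain F where F: "finite F" "F \<subseteq> B" "F \<noteq> {}" "s = finite_bound F"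
        by (auto simp: finite_bounds_def Fpow_def)
      obtain A where A: "A \<in> \<A>" "F \<subseteq> A"
        using finite_subset_Union_chain[OF F(1) _ \<A>(2,1)] F(2) U(1) by blast
      have "s \<in> finite_bounds A" using F A by (auto simp: finite_bounds_def Fpow_def)
      then have sA: "s \<in> sup_hull (finite_bounds A)" by (rule sup_hull.base)
      note sd = sigma_directed_generated[OF AX[OF A(1)]]
      have sG: "s \<in> \<Gamma>" using mem_Gamma[OF sd sA] .
      have "P s ` X \<subseteq> proj_on A ` X"
        unfolding P_range[OF sG] proj_on_range[OF AX[OF A(1)]]
        using lim_proj_fixed[OF sd sA] by (auto simp: proj_on_def)
      then show "P s ` X \<subseteq> (\<Union>A\<in>\<A>. proj_on A ` X)" using A(1) by blast
    qed
    then have "closure (\<Union>s\<in>finite_bounds B. P s ` X) \<subseteq> closure (\<Union>A\<in>\<A>. proj_on A ` X)"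
      by (rule closure_mono)
    moreover have "proj_on B ` X \<subseteq> closure (\<Union>s\<in>finite_bounds B. P s ` X)"
      unfolding proj_on_def using lim_proj_hull_dense directed_finite_bounds[OF U(2)] finite_bounds_eq_empty False by metis
    ultimately show ?thesis by blast
  qed
qed

section \<open>The projectional resolution of the identity\<close>

text \<open>
  The cardinal \<open>\<kappa>\<close> is a well-order on a dense set \<open>D\<close>, so ordinals up to \<open>\<kappa>\<close> are subsets of \<open>D\<close>
  and generate projections themselves. The values \<open>f a\<close> added to them make each step non-trivial.
\<close>

theorem exists_PRI:
  assumes nonsep: "\<not> separable X"
  shows "\<exists>Q. PRI smul X Q \<and>
    (\<forall>a \<in> Field (dens X). admits_one_skeleton TYPE('i) smul
       ((\<lambda>x. Q (under (dens X) a) x - Q (underS (dens X) a) x) ` X))"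
proof -
  obtain D where D: "dense_in X D" and dens: "dens X = |D|"
    using dens_attained[of X] by blast
  define \<kappa> where "\<kappa> = dens X"
  have \<kappa>: "\<kappa> = |D|" by (simp add: \<kappa>_def dens)
  have DX: "D \<subseteq> X" and XD: "X \<subseteq> closure D" using D by (auto simp: dense_in_def)
  have Field: "Field \<kappa> = D" by (simp add: \<kappa> Field_card_of)
  have card: "Card_order \<kappa>" by (simp add: \<kappa> card_of_Card_order)
  have well: "Well_order \<kappa>" by (simp add: \<kappa> card_of_Well_order)
  then interpret wo: wo_rel \<kappa> by (simp add: wo_rel_def)
  have wf: "wf (\<kappa> - Id)" using well by (simp add: well_order_on_def)
  have underS_D: "underS \<kappa> a \<subseteq> D" for a
    unfolding Field[symmetric] by (auto simp: underS_def Field_def)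

  \<comment> \<open>The range reached before \<open>a\<close> is not all of \<open>X\<close>: otherwise \<open>X\<close> would be separable or have a
    dense set of the cardinality of a proper initial segment of \<open>\<kappa>\<close>.\<close>
  have "\<exists>f. \<forall>a. a \<in> D \<longrightarrow> f a \<in> X \<and> proj_on (underS \<kappa> a \<union> f ` underS \<kappa> a) (f a) \<noteq> f a"
  proof (rule dependent_wf_choice[OF wf])
    fix f g :: "'a \<Rightarrow> 'a" and a r
    assume "\<And>b. (b, a) \<in> \<kappa> - Id \<Longrightarrow> f b = g b"
    then have "f ` underS \<kappa> a = g ` underS \<kappa> a"
      by (intro image_cong) (auto simp: underS_def)
    then show "(a \<in> D \<longrightarrow> r \<in> X \<and> proj_on (underS \<kappa> a \<union> f ` underS \<kappa> a) r \<noteq> r) =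
       (a \<in> D \<longrightarrow> r \<in> X \<and> proj_on (underS \<kappa> a \<union> g ` underS \<kappa> a) r \<noteq> r)" by simp
  next
    fix a and f :: "'a \<Rightarrow> 'a"
    assume IH: "\<And>b. (b, a) \<in> \<kappa> - Id \<Longrightarrow>
      b \<in> D \<longrightarrow> f b \<in> X \<and> proj_on (underS \<kappa> b \<union> f ` underS \<kappa> b) (f b) \<noteq> f b"
    define U where "U = underS \<kappa> a"
    define A where "A = U \<union> f ` U"
    have "f ` U \<subseteq> X" using IH underS_D[of a] by (auto simp: U_def underS_def)
    then have AX: "A \<subseteq> X" using underS_D[of a] DX by (auto simp: A_def U_def)
    have "\<exists>r\<in>X. proj_on A r \<noteq> r" if a: "a \<in> D"
    proof (rule ccontr)
      assume "\<not> ?thesis"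
      then have range: "proj_on A ` X = X" by (auto simp: proj_on_range[OF AX])
      obtain E where E: "dense_in X E" "countable E \<or> (infinite A \<and> |E| \<le>o |A| )"
        using proj_on_dense_subset[OF AX] unfolding range by blast
      have "|E| \<le>o |A|" and inf: "infinite A"
        using E nonsep by (auto simp: separable_iff_countable_dense)
      note \<open>|E| \<le>o |A|\<close>
      also have "|A| \<le>o |U|" unfolding A_def by (rule card_of_Un_image_le) (use inf A_def in simp)
      also have "|U| <o \<kappa>" unfolding U_def using card_of_underS[OF card] a Field by simp
      finally have "|E| <o \<kappa>" .
      moreover have "\<kappa> \<le>o |E|" unfolding \<kappa>_def by (rule dens_least[OF E(1)])
      ultimately show False using not_ordLess_ordLeq by blast
    qed
    then show "\<exists>r. a \<in> D \<longrightarrow> r \<in> X \<and> proj_on (underS \<kappa> a \<union> f ` underS \<kappa> a) r \<noteq> r"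
      unfolding A_def U_def by blast
  qed
  then obtain f where f: "\<And>a. a \<in> D \<Longrightarrow> f a \<in> X"
      "\<And>a. a \<in> D \<Longrightarrow> proj_on (underS \<kappa> a \<union> f ` underS \<kappa> a) (f a) \<noteq> f a" by blast

  define gen where "gen \<alpha> = \<alpha> \<union> f ` \<alpha>" for \<alpha>
  define Q where "Q \<alpha> = proj_on (gen \<alpha>)" for \<alpha>
  have sub_D: "\<alpha> \<subseteq> D" if "\<alpha> \<in> ordinals_upto \<kappa>" for \<alpha>
    using that Field by (auto simp: ordinals_upto_def wo.ofilter_def)
  have gen_X: "gen \<alpha> \<subseteq> X" if "\<alpha> \<subseteq> D" for \<alpha>
    using that DX f(1) by (auto simp: gen_def)
  have gen_mono: "gen \<alpha> \<subseteq> gen \<beta>" if "\<alpha> \<subseteq> \<beta>" for \<alpha> \<beta>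
    using that by (auto simp: gen_def)

  have "PRI smul X Q"
    unfolding PRI_def Let_def \<kappa>_def[symmetric]
  proof (intro conjI ballI allI impI)
    fix \<alpha> assume \<alpha>: "\<alpha> \<in> ordinals_upto \<kappa>"
    note X = gen_X[OF sub_D[OF \<alpha>]]
    show "bounded_projection smul X (Q \<alpha>)"
      unfolding Q_def proj_on_def
      by (rule bounded_projection_lim_proj[OF sigma_directed_generated[OF X]])
    show "opnorm_on X (Q \<alpha>) = 1" if "\<alpha> \<noteq> {}"
      unfolding Q_def by (rule opnorm_proj_on[OF X]) (use that in \<open>simp add: gen_def\<close>)
    obtain E where E: "dense_in (Q \<alpha> ` X) E" "countable E \<or> (infinite (gen \<alpha>) \<and> |E| \<le>o |gen \<alpha>| )"
      using proj_on_dense_subset[OF X] unfolding Q_def by blast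
    have "|E| \<le>o natLeq \<or> |E| \<le>o |\<alpha>|"
    proof (cases "countable E")
      case True
      then show ?thesis by (meson countable_card_le_natLeq)
    next
      case False
      then have "|E| \<le>o |gen \<alpha>|" "infinite (gen \<alpha>)" using E(2) by auto
      then have "|E| \<le>o |\<alpha>|"
        unfolding gen_def using ordLeq_transitive card_of_Un_image_le by metis
      then show ?thesis ..
    qed
    then show "dens (Q \<alpha> ` X) \<le>o natLeq \<or> dens (Q \<alpha> ` X) \<le>o |\<alpha>|"
      using ordLeq_transitive[OF dens_least[OF E(1)]] by metis
  next
    fix \<alpha> \<beta> x assume "\<alpha> \<in> ordinals_upto \<kappa>" "\<beta> \<in> ordinals_upto \<kappa>" "\<alpha> \<subseteq> \<beta>" and x: "x \<in> X"
    then have "gen \<alpha> \<subseteq> gen \<beta>" "gen \<beta> \<subseteq> X" using gen_mono gen_X[OF sub_D] by simp_all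
    then show "Q \<alpha> (Q \<beta> x) = Q \<alpha> x" "Q \<beta> (Q \<alpha> x) = Q \<alpha> x"
      unfolding Q_def using proj_on_below proj_on_above x by simp_all
  next
    fix x assume "x \<in> X"
    show "Q {} x = 0" by (simp add: Q_def gen_def proj_on_empty)
  next
    fix x assume x: "x \<in> X"
    note X = gen_X[OF order.refl]
    \<comment> \<open>Each \<open>a \<in> D\<close> belongs to the generating set of its own step, which is why \<open>gen\<close> contains
      \<open>\<alpha>\<close> and not only \<open>f ` \<alpha>\<close>.\<close>
    have "D \<subseteq> Q D ` X"
      unfolding Q_def proj_on_range[OF X] using proj_on_fixes[OF X] DX by (auto simp: gen_def)
    then have "closure D \<subseteq> Q D ` X"
      unfolding Q_def by (rule closure_minimal[OF _ closed_proj_on_range[OF X]])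
    then have "x \<in> Q D ` X" using XD x by blast
    then show "Q (Field \<kappa>) x = x"
      unfolding Field Q_def proj_on_range[OF X] by simp
  next
    fix \<mu> assume \<mu>: "limit_ordinal \<kappa> \<mu>"
    then have \<mu>o: "\<mu> \<in> ordinals_upto \<kappa>" "\<mu> \<noteq> {}" and lim: "\<And>a. a \<in> Field \<kappa> \<Longrightarrow> \<mu> \<noteq> under \<kappa> a"
      by (auto simp: limit_ordinal_def)
    define O\<mu> where "O\<mu> = {\<alpha>\<in>ordinals_upto \<kappa>. \<alpha> \<subset> \<mu>}"
    have under: "under \<kappa> a \<in> O\<mu>" "a \<in> under \<kappa> a" if a: "a \<in> \<mu>" for a
    proof -
      have aF: "a \<in> Field \<kappa>" using sub_D[OF \<mu>o(1)] a Field by blast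
      have "under \<kappa> a \<subset> \<mu>"
        using \<mu>o(1) a lim[OF aF] by (simp add: ordinals_upto_def wo.ofilter_def psubset_eq)
      moreover have "under \<kappa> a \<in> ordinals_upto \<kappa>"
        using wo.under_ofilter by (simp add: ordinals_upto_def)
      ultimately show "under \<kappa> a \<in> O\<mu>" by (simp add: O\<mu>_def)
      show "a \<in> under \<kappa> a" using wo.REFL aF by (simp add: under_def refl_on_def)
    qed
    have "subset.chain UNIV (gen ` O\<mu>)"
    proof (rule subset_chain_def[THEN iffD2], intro conjI ballI)
      fix A B assume "A \<in> gen ` O\<mu>" "B \<in> gen ` O\<mu>"
      then obtain \<alpha> \<beta> where "A = gen \<alpha>" "B = gen \<beta>" "wo.ofilter \<alpha>" "wo.ofilter \<beta>"
        by (auto simp: O\<mu>_def ordinals_upto_def)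
      then show "A \<subseteq> B \<or> B \<subseteq> A"
        using wo.ofilter_linord[of \<alpha> \<beta>] gen_mono[of \<alpha> \<beta>] gen_mono[of \<beta> \<alpha>] by blast
    qed auto
    moreover have "gen ` O\<mu> \<noteq> {}" using \<mu>o(2) under by blast
    moreover have "\<Union>(gen ` O\<mu>) = gen \<mu>"
    proof
      show "\<Union>(gen ` O\<mu>) \<subseteq> gen \<mu>" using gen_mono by (auto simp: O\<mu>_def)
      show "gen \<mu> \<subseteq> \<Union>(gen ` O\<mu>)" using under by (auto simp: gen_def)
    qed
    ultimately show "Q \<mu> ` X = closure (\<Union>\<alpha>\<in>{\<alpha>\<in>ordinals_upto \<kappa>. \<alpha> \<subset> \<mu>}. Q \<alpha> ` X)"
      using proj_on_chain[of "gen ` O\<mu>" "gen \<mu>"] gen_X[OF sub_D[OF \<mu>o(1)]]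
      by (simp add: Q_def O\<mu>_def)
  qed
  moreover have "admits_one_skeleton TYPE('i) smul ((\<lambda>x. Q (under \<kappa> a) x - Q (underS \<kappa> a) x) ` X)"
    if a: "a \<in> Field \<kappa>" for a
  proof -
    have aD: "a \<in> D" using a Field by simp
    have "under \<kappa> a \<subseteq> D" unfolding Field[symmetric] by (auto simp: under_def Field_def)
    then have X: "gen (under \<kappa> a) \<subseteq> X" by (rule gen_X)
    have sub: "gen (underS \<kappa> a) \<subseteq> gen (under \<kappa> a)"
      by (rule gen_mono) (auto simp: under_def underS_def)
    have "a \<in> under \<kappa> a" using wo.REFL a by (simp add: under_def refl_on_def)
    then have "f a \<in> gen (under \<kappa> a)" by (simp add: gen_def)
    then have "proj_on (gen (under \<kappa> a)) (f a) = f a" by (rule proj_on_fixes[OF X])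
    then show ?thesis
      unfolding Q_def
      using proj_on_difference[OF sub X f(1)[OF aD]] f(2)[OF aD] by (simp add: gen_def)
  qed
  ultimately show ?thesis unfolding \<kappa>_def by blast
qed

end

theorem theorem1p1:
  fixes smul :: "'k::real_normed_field \<Rightarrow> 'a::banach \<Rightarrow> 'a"
  assumes "normed_space_over smul"
  shows "(\<forall>X. banach_space smul X \<and> \<not> separable X \<and> admits_one_skeleton TYPE('i) smul X \<longrightarrow>
            (\<exists>P. PRI smul X P \<and>
              (\<forall>a \<in> Field (dens X).
                 admits_one_skeleton TYPE('i) smul
                   ((\<lambda>x. P (under (dens X) a) x - P (underS (dens X) a) x) ` X)))) \<and>
         P_class smul (admits_one_skeleton TYPE('i) smul)"
proof -
  have "\<exists>Q. PRI smul X Q \<and>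
      (\<forall>a \<in> Field (dens X). admits_one_skeleton TYPE('i) smul
         ((\<lambda>x. Q (under (dens X) a) x - Q (underS (dens X) a) x) ` X))"
    if nonsep: "\<not> separable X" and sk: "admits_one_skeleton TYPE('i) smul X" for X
  proof -
    obtain \<Gamma> :: "'i set" and le P where "one_projectional_skeleton smul X \<Gamma> le P"
      using sk by (auto simp: admits_one_skeleton_def)
    then interpret one_skeleton smul X \<Gamma> le P by unfold_locales
    show ?thesis by (rule exists_PRI[OF nonsep])
  qed
  then show ?thesis
    unfolding P_class_def PRI_piece_def by blast
qed

end
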